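(* Let $(A,\rho)$ be a selfless C*-probability space, where the state $\rho$ is faithful. Suppose that $A$ has real rank zero. Then the set of elements of the form $s+t$, with $s\in A$ normal and $t\in A$ nilpotent, is (norm) dense in $A$.
   Context: A C*-probability space is a pair $(A,\rho)$ with $A$ a unital C*-algebra and $\rho$ a state on $A$. An embedding $\theta\colon(A,\rho)\to(B,\tau)$ of C*-probability spaces is an injective unital *-homomorphism $\theta\colon A\to B$ with $\tau\circ\theta=\rho$. For an ultrafilter $\mathcal U$ on a set $I$, the ultrapower $(A^{\mathcal U},\rho^{\mathcal U})$ is given by the norm ultrapower $A^{\mathcal U}=\ell^\infty(I,A)/\{(x_i)_i:\lim_{\mathcal U}\|x_i\|=0\}$ and $\rho^{\mathcal U}([(x_i)_{i}])=\lim_{\mathcal U}\rho(x_i)$. The diagonal embedding $(A,\rho)\to(A^{\mathcal U},\rho^{\mathcal U})$ sends $a$ to the class of the constant family. An embedding $\theta\colon(A,\rho)\to(B,\tau)$ is existential if there exist an ultrafilter $\mathcal U$ (on some set) and an embedding $\sigma\colon(B,\tau)\to(A^{\mathcal U},\rho^{\mathcal U})$ such that $\sigma\theta$ is the diagonal embedding of $A$ in $A^{\mathcal U}$. $\ast$ denotes the reduced free product of C*-probability spaces whose states have faithful GNS representations (Avitzour, Voiculescu), equipped with its free product state and its canonical embeddings of the factors; the first factor embedding is the canonical embedding of the first factor. A C*-probability space $(A,\rho)$, with $\rho$ having faithful GNS representation, is selfless if $A\neq\mathbb{C}$ and the first factor embedding $(A,\rho)\hookrightarrow(A,\rho)*(A,\rho)$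 is existential. *)

theory Defs
  imports "HOL-Analysis.Analysis"
begin

subsection \<open>Unital C*-algebras\<close>

text \<open>
  As \<^class>\<open>real_normed_algebra_1\<close> requires \<open>norm 1 = 1\<close>, the zero algebra is excluded; it carries
  no state.
\<close>

class cstar_algebra = real_normed_algebra_1 + banach +
  fixes scaleC :: "complex \<Rightarrow> 'a \<Rightarrow> 'a"  (infixr \<open>*\<^sub>C\<close> 75)
    and star :: "'a \<Rightarrow> 'a"
  assumes scaleC_of_real: "of_real r *\<^sub>C x = r *\<^sub>R x"
    and scaleC_add_right: "c *\<^sub>C (x + y) = c *\<^sub>C x + c *\<^sub>C y"
    and scaleC_add_left: "(c + d) *\<^sub>C x = c *\<^sub>C x + d *\<^sub>C x"
    and scaleC_scaleC: "c *\<^sub>C (d *\<^sub>C x) = (c * d) *\<^sub>C x"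
    and mult_scaleC_left: "(c *\<^sub>C x) * y = c *\<^sub>C (x * y)"
    and mult_scaleC_right: "x * (c *\<^sub>C y) = c *\<^sub>C (x * y)"
    and norm_scaleC: "norm (c *\<^sub>C x) = cmod c * norm x"
    and star_star: "star (star x) = x"
    and star_add: "star (x + y) = star x + star y"
    and star_scaleC: "star (c *\<^sub>C x) = cnj c *\<^sub>C star x"
    and star_mult: "star (x * y) = star y * star x"
    and cstar_identity: "norm (star x * x) = (norm x)\<^sup>2"

instantiation complex :: cstar_algebra
begin

definition scaleC_complex :: "complex \<Rightarrow> complex \<Rightarrow> complex" where
  "scaleC_complex c x = c * x"

definition star_complex :: "complex \<Rightarrow> complex" where
  "star_complex x = cnj x"

instance
  by standard
    (auto simp: scaleC_complex_def star_complex_def algebra_simps norm_mult power2_eq_square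
       scaleR_conv_of_real)

end

lemma norm_star: "norm (star x) = norm (x :: 'a::cstar_algebra)"
proof -
  have le: "norm x \<le> norm (star x)" for x :: 'a
  proof (cases "x = 0")
    case False
    have "norm x * norm x \<le> norm (star x) * norm x"
      using norm_mult_ineq[of "star x" x] by (simp add: cstar_identity power2_eq_square)
    then show ?thesis using False by simp
  qed simp
  show ?thesis using le[of x] le[of "star x"] by (simp add: star_star)
qed

lemma scaleC_uminus: "(-1) *\<^sub>C x = - (x :: 'a::cstar_algebra)"
  using scaleC_of_real[of "-1" x] by simp

lemma scaleC_diff_right: "c *\<^sub>C (x - y) = c *\<^sub>C x - c *\<^sub>C (y :: 'a::cstar_algebra)"
  using scaleC_add_right[of c "x - y" y] by (simp add: eq_diff_eq)

lemma star_diff: "star (x - y) = star x - star (y :: 'a::cstar_algebra)"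
  using star_add[of "x - y" y] by (simp add: eq_diff_eq)

definition normal_element :: "'a::cstar_algebra \<Rightarrow> bool" where
  "normal_element x \<longleftrightarrow> star x * x = x * star x"

definition nilpotent_element :: "'a::cstar_algebra \<Rightarrow> bool" where
  "nilpotent_element x \<longleftrightarrow> (\<exists>n. x ^ n = 0)"

definition self_adjoint :: "'a::cstar_algebra \<Rightarrow> bool" where
  "self_adjoint x \<longleftrightarrow> star x = x"

definition invertible_element :: "'a::cstar_algebra \<Rightarrow> bool" where
  "invertible_element x \<longleftrightarrow> (\<exists>y. x * y = 1 \<and> y * x = 1)"

text \<open>Real rank zero: every self-adjoint element is a norm limit of invertible self-adjoint ones.\<close>

definition real_rank_zero :: "'a::cstar_algebra itself \<Rightarrow> bool" where
  "real_rank_zero A \<longleftrightarrow>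
     {x :: 'a. self_adjoint x} \<subseteq> closure {x. self_adjoint x \<and> invertible_element x}"

definition cstar_subalgebra :: "'a::cstar_algebra set \<Rightarrow> bool" where
  "cstar_subalgebra S \<longleftrightarrow> closed S \<and> 1 \<in> S \<and>
     (\<forall>x\<in>S. \<forall>y\<in>S. x + y \<in> S \<and> x * y \<in> S) \<and> (\<forall>x\<in>S. star x \<in> S \<and> (\<forall>c. c *\<^sub>C x \<in> S))"

subsection \<open>States\<close>

definition state :: "('a::cstar_algebra \<Rightarrow> complex) \<Rightarrow> bool" where
  "state \<rho> \<longleftrightarrow> (\<forall>x y. \<rho> (x + y) = \<rho> x + \<rho> y) \<and> (\<forall>c x. \<rho> (c *\<^sub>C x) = c * \<rho> x) \<and>
     (\<forall>x. \<rho> (star x * x) \<in> \<real>\<^sub>\<ge>\<^sub>0) \<and> \<rho> 1 = 1"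

definition faithful_state :: "('a::cstar_algebra \<Rightarrow> complex) \<Rightarrow> bool" where
  "faithful_state \<rho> \<longleftrightarrow> state \<rho> \<and> (\<forall>x. \<rho> (star x * x) = 0 \<longrightarrow> x = 0)"

text \<open>
  The GNS Hilbert space is the completion of the space of classes \<open>gns_class \<rho> x\<close>, the quotient of
  the algebra by the left ideal of all \<open>x\<close> with \<open>\<rho> (x\<^sup>* x) = 0\<close>. The representation is given here on
  this dense subspace; as it is by bounded operators, this does not affect its injectivity.
\<close>

definition gns_class :: "('a::cstar_algebra \<Rightarrow> complex) \<Rightarrow> 'a \<Rightarrow> 'a set" where
  "gns_class \<rho> x = {y. \<rho> (star (y - x) * (y - x)) = 0}"

definition gns_rep :: "('a::cstar_algebra \<Rightarrow> complex) \<Rightarrow> 'a \<Rightarrow> 'a set \<Rightarrow> 'a set" where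
  "gns_rep \<rho> a = restrict (\<lambda>X. \<Union>x\<in>X. gns_class \<rho> (a * x)) (range (gns_class \<rho>))"

lemma state_null:
  assumes st: "state \<rho>" and x: "\<rho> (star x * x) = 0"
  shows "\<rho> (star y * x) = 0" "\<rho> (star x * y) = 0"
proof -
  have add: "\<rho> (a + b) = \<rho> a + \<rho> b" and sc: "\<rho> (c *\<^sub>C a) = c * \<rho> a"
    and pos: "\<rho> (star a * a) \<in> \<real>\<^sub>\<ge>\<^sub>0" for a b c
    using st by (auto simp: state_def)
  let ?p = "\<rho> (star y * x)" and ?q = "\<rho> (star x * y)" and ?r = "\<rho> (star y * y)"
  have main: "?r + c * ?p + cnj c * ?q \<in> \<real>\<^sub>\<ge>\<^sub>0" for c
  proof -
    have "star (y + c *\<^sub>C x) * (y + c *\<^sub>C x) =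
        star y * y + c *\<^sub>C (star y * x) + cnj c *\<^sub>C (star x * y) + cnj c *\<^sub>C c *\<^sub>C (star x * x)"
      by (simp add: star_add star_scaleC mult_scaleC_left mult_scaleC_right distrib_left distrib_right
          scaleC_add_right scaleC_scaleC ac_simps)
    then show ?thesis using pos[of "y + c *\<^sub>C x"] x by (simp add: add sc)
  qed
  have r: "Re ?r \<ge> 0" "Im ?r = 0"
    using pos[of y] by (auto simp: complex_nonneg_Reals_iff)
  have q: "?q = cnj ?p"
    using main[of 1] main[of \<i>] r by (auto simp: complex_nonneg_Reals_iff complex_eq_iff)
  have lin: "0 \<le> Re ?r - 2 * s * (cmod ?p)\<^sup>2" for s :: real
    using main[of "- of_real s * cnj ?p"]
    unfolding cmod_power2 by (simp add: complex_nonneg_Reals_iff q algebra_simps power2_eq_square)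
  have "?p = 0"
  proof (rule ccontr)
    assume "?p \<noteq> 0"
    then show False using lin[of "(Re ?r + 1) / (2 * (cmod ?p)\<^sup>2)"] by simp
  qed
  then show "?p = 0" "?q = 0" by (simp_all add: q)
qed

lemma gns_class_cong:
  assumes st: "state \<rho>" and "y \<in> gns_class \<rho> x"
  shows "gns_class \<rho> y = gns_class \<rho> x"
proof -
  have add: "\<rho> (a + b) = \<rho> a + \<rho> b" for a b
    using st by (auto simp: state_def)
  have sum0: "\<rho> (star (a + b) * (a + b)) = 0"
    if "\<rho> (star a * a) = 0" "\<rho> (star b * b) = 0" for a b
    using that state_null[OF st that(1), of b] by (simp add: star_add distrib_left distrib_right add)
  have sym: "star (a - b) * (a - b) = star (b - a) * (b - a)" for a b :: 'a
    by (simp add: star_diff algebra_simps)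
  have "z \<in> gns_class \<rho> v" if "z \<in> gns_class \<rho> w" "w \<in> gns_class \<rho> v" for z w v
    using sum0[of "z - w" "w - v"] that by (simp add: gns_class_def)
  moreover have "x \<in> gns_class \<rho> y"
    using assms(2) sym[of x y] by (simp add: gns_class_def)
  ultimately show ?thesis using assms(2) by blast
qed

lemma gns_rep_class:
  assumes st: "state \<rho>"
  shows "gns_rep \<rho> a (gns_class \<rho> x) = gns_class \<rho> (a * x)"
proof -
  have \<rho>0: "\<rho> 0 = 0"
    using st unfolding state_def by (metis add_cancel_right_right)
  have x: "x \<in> gns_class \<rho> x"
    by (simp add: gns_class_def \<rho>0)
  have "gns_class \<rho> (a * y) = gns_class \<rho> (a * x)" if "y \<in> gns_class \<rho> x" for y
  proof (rule gns_class_cong[OF st])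
    have "\<rho> (star (star a * (a * (y - x))) * (y - x)) = 0"
      by (rule state_null(1)[OF st]) (use that in \<open>simp add: gns_class_def\<close>)
    then show "a * y \<in> gns_class \<rho> (a * x)"
      by (simp add: gns_class_def star_mult star_star mult.assoc flip: right_diff_distrib)
  qed
  then have "(\<Union>y\<in>gns_class \<rho> x. gns_class \<rho> (a * y)) = gns_class \<rho> (a * x)"
    using x by blast
  then show ?thesis by (simp add: gns_rep_def)
qed

definition faithful_gns :: "('a::cstar_algebra \<Rightarrow> complex) \<Rightarrow> bool" where
  "faithful_gns \<rho> \<longleftrightarrow> inj (gns_rep \<rho>)"

subsection \<open>Embeddings of C*-probability spaces\<close>

text \<open>A C*-probability space is a type of class \<^class>\<open>cstar_algebra\<close> with a \<^const>\<open>state\<close> on it.\<close>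

definition embedding ::
  "('a::cstar_algebra \<Rightarrow> complex) \<Rightarrow> ('b::cstar_algebra \<Rightarrow> complex) \<Rightarrow> ('a \<Rightarrow> 'b) \<Rightarrow> bool" where
  "embedding \<rho> \<tau> \<theta> \<longleftrightarrow> inj \<theta> \<and> \<theta> 1 = 1 \<and>
     (\<forall>x y. \<theta> (x + y) = \<theta> x + \<theta> y) \<and> (\<forall>c x. \<theta> (c *\<^sub>C x) = c *\<^sub>C \<theta> x) \<and>
     (\<forall>x y. \<theta> (x * y) = \<theta> x * \<theta> y) \<and> (\<forall>x. \<theta> (star x) = star (\<theta> x)) \<and>
     (\<forall>x. \<tau> (\<theta> x) = \<rho> x)"

subsection \<open>Ultrapowers\<close>

definition ultrafilter :: "'i filter \<Rightarrow> bool" where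
  "ultrafilter U \<longleftrightarrow> U \<noteq> bot \<and> (\<forall>P. eventually P U \<or> eventually (\<lambda>i. \<not> P i) U)"

definition bounded_families :: "('i \<Rightarrow> 'a::cstar_algebra) set" where
  "bounded_families = {x. bounded (range x)}"

text \<open>
  Since the ultrapower depends on the term \<open>U\<close>, it is not a type but a set of cosets, with the
  operations induced by the pointwise ones.
\<close>

definition up_class :: "'i filter \<Rightarrow> ('i \<Rightarrow> 'a::cstar_algebra) \<Rightarrow> ('i \<Rightarrow> 'a) set" where
  "up_class U x = {y \<in> bounded_families. ((\<lambda>i. norm (y i - x i)) \<longlongrightarrow> 0) U}"

definition ultrapower :: "'i filter \<Rightarrow> ('i \<Rightarrow> 'a::cstar_algebra) set set" where
  "ultrapower U = up_class U ` bounded_families"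

definition up_add where
  "up_add U X Y = (\<Union>x\<in>X. \<Union>y\<in>Y. up_class U (\<lambda>i. x i + y i))"

definition up_mult where
  "up_mult U X Y = (\<Union>x\<in>X. \<Union>y\<in>Y. up_class U (\<lambda>i. x i * y i))"

definition up_scaleC where
  "up_scaleC U c X = (\<Union>x\<in>X. up_class U (\<lambda>i. c *\<^sub>C x i))"

definition up_star where
  "up_star U X = (\<Union>x\<in>X. up_class U (\<lambda>i. star (x i)))"

lemma up_class_self: "x \<in> bounded_families \<Longrightarrow> x \<in> up_class U x"
  by (simp add: up_class_def)

lemma up_class_cong:
  assumes "((\<lambda>i. norm (x i - y i)) \<longlongrightarrow> 0) U"
  shows "up_class U x = up_class U y"
proof -
  have sub: "up_class U v \<subseteq> up_class U w"
    if "((\<lambda>i. norm (v i - w i)) \<longlongrightarrow> 0) U" for v w :: "'a \<Rightarrow> 'b"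
  proof
    fix z assume z: "z \<in> up_class U v"
    then have "((\<lambda>i. (z i - v i) + (v i - w i)) \<longlongrightarrow> 0) U"
      using that by (intro tendsto_add_zero) (simp_all add: up_class_def tendsto_norm_zero_iff)
    then show "z \<in> up_class U w"
      using z by (simp add: up_class_def tendsto_norm_zero_iff)
  qed
  have "((\<lambda>i. norm (y i - x i)) \<longlongrightarrow> 0) U"
    using assms by (subst norm_minus_commute)
  then show ?thesis using sub assms by blast
qed

lemma UN_up_class:
  assumes "x \<in> bounded_families"
    and "\<And>x'. x' \<in> up_class U x \<Longrightarrow> ((\<lambda>i. norm (F x' i - F x i)) \<longlongrightarrow> 0) U"
  shows "(\<Union>x'\<in>up_class U x. up_class U (F x')) = up_class U (F x)"
proof -
  have "up_class U (F x') = up_class U (F x)" if "x' \<in> up_class U x" for x'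
    using assms(2)[OF that] by (rule up_class_cong)
  then show ?thesis using up_class_self[OF assms(1), of U] by blast
qed

lemma UN2_up_class:
  assumes "x \<in> bounded_families" "y \<in> bounded_families"
    and "\<And>x' y'. x' \<in> up_class U x \<Longrightarrow> y' \<in> up_class U y \<Longrightarrow>
           ((\<lambda>i. norm (F x' y' i - F x y i)) \<longlongrightarrow> 0) U"
  shows "(\<Union>x'\<in>up_class U x. \<Union>y'\<in>up_class U y. up_class U (F x' y')) = up_class U (F x y)"
proof -
  have "up_class U (F x' y') = up_class U (F x y)" if "x' \<in> up_class U x" "y' \<in> up_class U y" for x' y'
    using assms(3)[OF that] by (rule up_class_cong)
  then show ?thesis
    using up_class_self[OF assms(1), of U] up_class_self[OF assms(2), of U] by blast
qed

lemma up_add_class: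
  assumes "x \<in> bounded_families" "y \<in> bounded_families"
  shows "up_add U (up_class U x) (up_class U y) = up_class U (\<lambda>i. x i + y i)"
  unfolding up_add_def
proof (rule UN2_up_class[OF assms])
  fix x' y' assume "x' \<in> up_class U x" "y' \<in> up_class U y"
  then have "((\<lambda>i. (x' i - x i) + (y' i - y i)) \<longlongrightarrow> 0) U"
    by (auto simp: up_class_def tendsto_norm_zero_iff intro: tendsto_add_zero)
  then show "((\<lambda>i. norm (x' i + y' i - (x i + y i))) \<longlongrightarrow> 0) U"
    by (simp add: tendsto_norm_zero_iff algebra_simps)
qed

lemma up_mult_class:
  assumes "x \<in> bounded_families" "y \<in> bounded_families"
  shows "up_mult U (up_class U x) (up_class U y) = up_class U (\<lambda>i. x i * y i)"
  unfolding up_mult_def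
proof (rule UN2_up_class[OF assms])
  fix x' y' assume x': "x' \<in> up_class U x" and y': "y' \<in> up_class U y"
  obtain K L where K: "\<And>i. norm (y' i) \<le> K" and L: "\<And>i. norm (x i) \<le> L"
    using y' assms(1) by (auto simp: up_class_def bounded_families_def bounded_iff)
  have *: "norm (x' i * y' i - x i * y i) \<le> norm (x' i - x i) * K + L * norm (y' i - y i)" for i
  proof -
    have "x' i * y' i - x i * y i = (x' i - x i) * y' i + x i * (y' i - y i)"
      by (simp add: algebra_simps)
    then show ?thesis
      using norm_mult_ineq[of "x' i - x i" "y' i"] norm_mult_ineq[of "x i" "y' i - y i"]
        mult_left_mono[OF K, of "norm (x' i - x i)" i] mult_right_mono[OF L, of "norm (y' i - y i)" i]
        norm_triangle_ineq[of "(x' i - x i) * y' i" "x i * (y' i - y i)"] by simp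
  qed
  have "((\<lambda>i. norm (x' i - x i) * K + L * norm (y' i - y i)) \<longlongrightarrow> 0) U"
    using x' y' by (auto simp: up_class_def
        intro!: tendsto_add_zero tendsto_mult_left_zero tendsto_mult_right_zero)
  then show "((\<lambda>i. norm (x' i * y' i - x i * y i)) \<longlongrightarrow> 0) U"
    using * by (intro tendsto_norm_zero, elim Lim_null_comparison[OF always_eventually, rotated]) simp
qed

lemma up_scaleC_class:
  assumes "x \<in> bounded_families"
  shows "up_scaleC U c (up_class U x) = up_class U (\<lambda>i. c *\<^sub>C x i)"
  unfolding up_scaleC_def
  by (rule UN_up_class[OF assms])
    (auto simp: up_class_def norm_scaleC simp flip: scaleC_diff_right intro: tendsto_mult_right_zero)

lemma up_star_class:
  assumes "x \<in> bounded_families"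
  shows "up_star U (up_class U x) = up_class U (\<lambda>i. star (x i))"
  unfolding up_star_def
  by (rule UN_up_class[OF assms]) (auto simp: up_class_def norm_star simp flip: star_diff)

definition up_diag :: "'i filter \<Rightarrow> 'a::cstar_algebra \<Rightarrow> ('i \<Rightarrow> 'a) set" where
  "up_diag U a = up_class U (\<lambda>_. a)"

definition up_state ::
  "'i filter \<Rightarrow> ('a::cstar_algebra \<Rightarrow> complex) \<Rightarrow> ('i \<Rightarrow> 'a) set \<Rightarrow> complex" where
  "up_state U \<rho> X = (THE l. \<exists>x\<in>X. ((\<lambda>i. \<rho> (x i)) \<longlongrightarrow> l) U)"

definition ultrapower_embedding ::
  "'i filter \<Rightarrow> ('b::cstar_algebra \<Rightarrow> complex) \<Rightarrow> ('a::cstar_algebra \<Rightarrow> complex) \<Rightarrow>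
     ('b \<Rightarrow> ('i \<Rightarrow> 'a) set) \<Rightarrow> bool" where
  "ultrapower_embedding U \<tau> \<rho> \<sigma> \<longleftrightarrow> range \<sigma> \<subseteq> ultrapower U \<and> inj \<sigma> \<and> \<sigma> 1 = up_diag U 1 \<and>
     (\<forall>x y. \<sigma> (x + y) = up_add U (\<sigma> x) (\<sigma> y)) \<and> (\<forall>c x. \<sigma> (c *\<^sub>C x) = up_scaleC U c (\<sigma> x)) \<and>
     (\<forall>x y. \<sigma> (x * y) = up_mult U (\<sigma> x) (\<sigma> y)) \<and> (\<forall>x. \<sigma> (star x) = up_star U (\<sigma> x)) \<and>
     (\<forall>x. up_state U \<rho> (\<sigma> x) = \<tau> x)"

text \<open>
  The index set of the ultrafilter is the universe of the type \<open>'i\<close>. HOL cannot quantify over types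
  inside a formula; when \<open>existential\<close> is a hypothesis of a theorem in which \<open>'i\<close> is a free type
  variable, the theorem covers ultrafilters on all index sets.
\<close>

definition existential ::
  "'i itself \<Rightarrow> ('a::cstar_algebra \<Rightarrow> complex) \<Rightarrow> ('b::cstar_algebra \<Rightarrow> complex) \<Rightarrow>
     ('a \<Rightarrow> 'b) \<Rightarrow> bool" where
  "existential I \<rho> \<tau> \<theta> \<longleftrightarrow> embedding \<rho> \<tau> \<theta> \<and>
     (\<exists>(U :: 'i filter) \<sigma>. ultrafilter U \<and> ultrapower_embedding U \<tau> \<rho> \<sigma> \<and>
        (\<forall>a. \<sigma> (\<theta> a) = up_diag U a))"

subsection \<open>Reduced free products\<close>

text \<open>
  Free independence of a family of sets: alternating products of centred elements are centred. The
  list entry \<open>(k, b)\<close> stands for the factor \<open>b\<close> taken from \<open>S k\<close>.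
\<close>

definition free_family :: "('b::cstar_algebra \<Rightarrow> complex) \<Rightarrow> ('k \<Rightarrow> 'b set) \<Rightarrow> bool" where
  "free_family \<tau> S \<longleftrightarrow>
     (\<forall>ws. ws \<noteq> [] \<and> distinct_adj (map fst ws) \<and> (\<forall>(k, b)\<in>set ws. b \<in> S k \<and> \<tau> b = 0) \<longrightarrow>
        \<tau> (prod_list (map snd ws)) = 0)"

text \<open>
  \<open>(B, \<tau>)\<close> with factor embeddings \<open>\<theta>\<^sub>1\<close>, \<open>\<theta>\<^sub>2\<close> is the reduced free product of \<open>(A\<^sub>1, \<rho>\<^sub>1)\<close> and
  \<open>(A\<^sub>2, \<rho>\<^sub>2)\<close>: the factors are free with respect to \<open>\<tau>\<close> and generate \<open>B\<close> as a C*-algebra, and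
  the GNS representation of \<open>\<tau>\<close> is faithful. These properties determine \<open>(B, \<tau>, \<theta>\<^sub>1, \<theta>\<^sub>2)\<close> up to a
  unique state-preserving isomorphism, and the algebra that Avitzour and Voiculescu construct on the
  free product of the two GNS spaces has them.
\<close>

definition reduced_free_product ::
  "('a1::cstar_algebra \<Rightarrow> complex) \<Rightarrow> ('a2::cstar_algebra \<Rightarrow> complex) \<Rightarrow>
     ('b::cstar_algebra \<Rightarrow> complex) \<Rightarrow> ('a1 \<Rightarrow> 'b) \<Rightarrow> ('a2 \<Rightarrow> 'b) \<Rightarrow> bool" where
  "reduced_free_product \<rho>1 \<rho>2 \<tau> \<theta>1 \<theta>2 \<longleftrightarrow>
     state \<rho>1 \<and> faithful_gns \<rho>1 \<and> state \<rho>2 \<and> faithful_gns \<rho>2 \<and> state \<tau> \<and> faithful_gns \<tau> \<and>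
     embedding \<rho>1 \<tau> \<theta>1 \<and> embedding \<rho>2 \<tau> \<theta>2 \<and>
     free_family \<tau> (\<lambda>k. if k then range \<theta>1 else range \<theta>2) \<and>
     cstar_subalgebra hull (range \<theta>1 \<union> range \<theta>2) = UNIV"

subsection \<open>Selflessness\<close>

text \<open>
  The type \<open>'b\<close> carries the reduced free product of the space with itself and \<open>'i\<close> is the index set
  of the ultrafilter. As with \<^const>\<open>existential\<close>, a hypothesis \<open>selfless\<close> with free type variables
  \<open>'b\<close> and \<open>'i\<close> expresses selflessness without a restriction on either.
\<close>

definition selfless ::
  "'b::cstar_algebra itself \<Rightarrow> 'i itself \<Rightarrow> ('a::cstar_algebra \<Rightarrow> complex) \<Rightarrow> bool" where
  "selfless B I \<rho> \<longleftrightarrow> state \<rho> \<and> faithful_gns \<rho> \<and> range (\<lambda>c. c *\<^sub>C (1 :: 'a)) \<noteq> UNIV \<and>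
     (\<exists>(\<tau> :: 'b \<Rightarrow> complex) \<theta>1 \<theta>2. reduced_free_product \<rho> \<rho> \<tau> \<theta>1 \<theta>2 \<and> existential I \<rho> \<tau> \<theta>1)"

end

theory Submission
  imports Defs
begin

text \<open>
  A compression estimate drives the proof: if \<open>a\<close> is centred and the projection \<open>p\<close> is free from
  \<open>a\<close>, then \<open>\<parallel>p a p\<parallel> \<le> 2 (\<tau> p)\<^sup>1\<^sup>/\<^sup>2 \<parallel>a\<parallel>\<close>. Given a partition of unity into projections of small
  state in the second factor of the free product, selflessness moves it into \<open>A\<close>, where it makes all
  diagonal blocks of \<open>a\<close> close to the scalar \<open>\<rho> a\<close>. Up to a small error, \<open>a\<close> is then \<open>\<rho> a + L + V\<close> with
  \<open>L\<close> strictly lower and \<open>V\<close> strictly upper triangular, hence the sum of the normal element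
  \<open>\<rho> a + L + L\<^sup>*\<close> and the nilpotent element \<open>V - L\<^sup>*\<close>. The partition exists because a projection \<open>e\<close>
  whose subprojections all have state near \<open>0\<close> or near \<open>\<rho> e\<close> would, by real rank zero, give every
  self-adjoint \<open>h\<close> in the corner of \<open>e\<close> small variance, whereas \<open>h = e x e\<close> with \<open>x\<close> almost free
  from \<open>e\<close> has variance bounded below.
\<close>

text \<open>The splitting of projections must be uniform: cutting repeatedly, with no control on how
  unequal the pieces are, need not reach small states in finitely many steps. Uniformity comes from
  a moment formula: if \<open>x\<close> is centred with second moment \<open>\<beta>\<close> and
  free from \<open>e\<close>, then \<open>e * x * e\<close> is centred and its second moment is
  \<open>\<beta>\<close> times the square of the state of \<open>e\<close>, so the lower bound on
  the variance depends on \<open>e\<close> only through its state. Real rank zero only supplies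
  invertible elements of the whole algebra; a Schur complement turns one near
  \<open>h + (1 - e)\<close> into one that commutes with \<open>e\<close>. Signs, absolute values
  and norm estimates all rest on two tools that replace spectral theory: the binomial series of the
  square root, which commutes with whatever commutes with its argument, and the fact that a state
  with injective GNS representation recovers the norm as an operator norm. The second tool is also
  what carries norm bounds from the free product back through the ultrapower.\<close>

subsection \<open>Square roots and absolute values\<close>

text \<open>The Taylor coefficients of \<open>sqrt (1 - z)\<close> at \<open>0\<close>.\<close>

definition sqrt_coeff :: "nat \<Rightarrow> real" where
  "sqrt_coeff n = (-1) ^ n * ((1/2) gchoose n)"

lemma sqrt_coeff_0 [simp]: "sqrt_coeff 0 = 1"
  by (simp add: sqrt_coeff_def)

lemma sqrt_coeff_conv: "sqrt_coeff n = pochhammer (- (1/2)) n / fact n"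
  by (simp add: sqrt_coeff_def gbinomial_pochhammer flip: power_mult_distrib mult.assoc)

lemma sqrt_coeff_Suc_nonpos: "sqrt_coeff (Suc n) \<le> 0"
proof -
  have "pochhammer (1/2::real) n \<ge> 0"
    by (rule pochhammer_nonneg) simp
  then show ?thesis
    by (simp add: sqrt_coeff_conv pochhammer_rec divide_nonpos_pos field_simps)
qed

text \<open>Multiplying a power series by \<open>1 / (1 - z)\<close> sums its coefficients, so these
  partial sums are the Taylor coefficients of \<open>1 / sqrt (1 - z)\<close>, none of which is
  negative.\<close>

lemma sum_sqrt_coeff_nonneg: "(\<Sum>k\<le>n. sqrt_coeff k) \<ge> 0"
proof -
  have "(\<Sum>k\<le>n. sqrt_coeff k) = (\<Sum>k\<le>n. ((1/2) gchoose k) * (-1) ^ k)"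
    by (simp add: sqrt_coeff_def mult.commute)
  also have "\<dots> = (-1) ^ n * ((1/2 - 1) gchoose n)"
    by (rule gbinomial_sum_lower_neg)
  also have "\<dots> = pochhammer (1/2) n / fact n"
    by (simp add: gbinomial_pochhammer flip: power_mult_distrib mult.assoc)
  also have "\<dots> \<ge> 0"
    by (intro divide_nonneg_pos pochhammer_nonneg) auto
  finally show ?thesis .
qed

text \<open>All coefficients after the first are nonpositive, so the absolute sum is
  \<open>1\<close> minus a partial sum. The exact bound \<open>1\<close> is what makes
  \<open>sqrt_rem\<close> norm-decreasing.\<close>

lemma sum_abs_sqrt_coeff_Suc: "(\<Sum>k<n. \<bar>sqrt_coeff (Suc k)\<bar>) \<le> 1"
proof -
  have "(\<Sum>k<n. \<bar>sqrt_coeff (Suc k)\<bar>) = - (\<Sum>k<n. sqrt_coeff (Suc k))"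
    by (simp add: sum_negf[symmetric] abs_of_nonpos sqrt_coeff_Suc_nonpos)
  also have "\<dots> = 1 - (\<Sum>k\<le>n. sqrt_coeff k)"
    by (simp add: sum.atMost_shift)
  finally show ?thesis using sum_sqrt_coeff_nonneg[of n] by simp
qed

lemma summable_abs_sqrt_coeff_Suc: "summable (\<lambda>k. \<bar>sqrt_coeff (Suc k)\<bar>)"
  by (rule summableI_nonneg_bounded[of _ 1]) (auto simp: sum_abs_sqrt_coeff_Suc)

text \<open>Vandermonde's identity for \<open>1/2 + 1/2 = 1\<close>: the square of the series is
  \<open>1 - z\<close>, coefficient by coefficient.\<close>

lemma sqrt_coeff_convolution:
  "(\<Sum>k\<le>n. sqrt_coeff k * sqrt_coeff (n - k)) = (if n = 0 then 1 else if n = 1 then -1 else 0)"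
proof -
  have "(\<Sum>k\<le>n. sqrt_coeff k * sqrt_coeff (n - k)) =
      (\<Sum>k\<le>n. (-1) ^ n * (((1/2) gchoose k) * ((1/2) gchoose (n - k))))"
    by (intro sum.cong) (auto simp: sqrt_coeff_def simp flip: power_add)
  also have "\<dots> = (-1) ^ n * ((1/2 + 1/2) gchoose n)"
    unfolding gbinomial_Vandermonde[of "1/2" "1/2" n, symmetric] by (simp only: sum_distrib_left atMost_atLeast0)
  also have "\<dots> = (-1) ^ n * of_nat (1 choose n)"
    by (metis (no_types) binomial_gbinomial field_sum_of_halves of_nat_1)
  also have "\<dots> = (if n = 0 then 1 else if n = 1 then -1 else 0)"
    by (auto simp: binomial_eq_0)
  finally show ?thesis .
qed

text \<open>
  The binomial series of \<open>sqrt (1 - z)\<close>; it converges absolutely even if \<open>norm z = 1\<close>.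
\<close>

definition sqrt_rem :: "'a::cstar_algebra \<Rightarrow> 'a" where
  "sqrt_rem z = - (\<Sum>n. sqrt_coeff (Suc n) *\<^sub>R z ^ Suc n)"

definition sqrt1m :: "'a::cstar_algebra \<Rightarrow> 'a" where
  "sqrt1m z = 1 - sqrt_rem z"

text \<open>The norm bound keeps \<open>sqrt_rem z\<close> in the unit ball, so the series can be
  applied to it again; this is how the root of an absolute value is formed. It also puts
  \<open>sqrt1m z\<close> close to \<open>1\<close> for small \<open>z\<close>.\<close>

lemma
  fixes z :: "'a::cstar_algebra"
  assumes z: "norm z \<le> 1"
  shows summable_sqrt_rem: "summable (\<lambda>n. norm (sqrt_coeff (Suc n) *\<^sub>R z ^ Suc n))"
    and norm_sqrt_rem: "norm (sqrt_rem z) \<le> norm z"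
proof -
  have le: "norm (sqrt_coeff (Suc n) *\<^sub>R z ^ Suc n) \<le> \<bar>sqrt_coeff (Suc n)\<bar> * norm z" for n
  proof -
    have "norm (z ^ Suc n) \<le> norm z ^ Suc n" by (rule norm_power_ineq)
    also have "\<dots> \<le> norm z" using z by (simp add: mult_left_le power_le_one)
    finally show ?thesis by (simp add: mult_left_mono)
  qed
  have sm: "summable (\<lambda>n. \<bar>sqrt_coeff (Suc n)\<bar> * norm z)"
    by (intro summable_mult2 summable_abs_sqrt_coeff_Suc)
  show s: "summable (\<lambda>n. norm (sqrt_coeff (Suc n) *\<^sub>R z ^ Suc n))"
    by (rule summable_comparison_test'[OF sm, of 0]) (use le in auto)
  have "norm (sqrt_rem z) \<le> (\<Sum>n. norm (sqrt_coeff (Suc n) *\<^sub>R z ^ Suc n))"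
    unfolding sqrt_rem_def norm_minus_cancel by (rule summable_norm[OF s])
  also have "\<dots> \<le> (\<Sum>n. \<bar>sqrt_coeff (Suc n)\<bar> * norm z)"
    by (rule suminf_le[OF le s sm])
  also have "\<dots> = (\<Sum>n. \<bar>sqrt_coeff (Suc n)\<bar>) * norm z"
    by (rule suminf_mult2[OF summable_abs_sqrt_coeff_Suc, symmetric])
  also have "\<dots> \<le> 1 * norm z"
    by (intro mult_right_mono suminf_le_const summable_abs_sqrt_coeff_Suc sum_abs_sqrt_coeff_Suc) simp
  finally show "norm (sqrt_rem z) \<le> norm z" by simp
qed

lemma sqrt1m_sums:
  fixes z :: "'a::cstar_algebra"
  assumes z: "norm z \<le> 1"
  shows "(\<lambda>n. sqrt_coeff n *\<^sub>R z ^ n) sums sqrt1m z"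
    and "summable (\<lambda>n. norm (sqrt_coeff n *\<^sub>R z ^ n))"
proof -
  have "(\<lambda>n. sqrt_coeff (Suc n) *\<^sub>R z ^ Suc n) sums (sqrt1m z - sqrt_coeff 0 *\<^sub>R z ^ 0)"
    using summable_sums[OF summable_norm_cancel[OF summable_sqrt_rem[OF z]]]
    by (simp add: sqrt1m_def sqrt_rem_def)
  then show "(\<lambda>n. sqrt_coeff n *\<^sub>R z ^ n) sums sqrt1m z"
    by (subst (asm) sums_Suc_iff) simp
  show "summable (\<lambda>n. norm (sqrt_coeff n *\<^sub>R z ^ n))"
    by (subst summable_Suc_iff[symmetric]) (rule summable_sqrt_rem[OF z])
qed

lemma sqrt1m_square:
  fixes z :: "'a::cstar_algebra"
  assumes z: "norm z \<le> 1"
  shows "sqrt1m z * sqrt1m z = 1 - z"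
proof -
  let ?f = "\<lambda>n. sqrt_coeff n *\<^sub>R z ^ n"
  have "(\<lambda>n. \<Sum>i\<le>n. ?f i * ?f (n - i)) sums (suminf ?f * suminf ?f)"
    by (rule Cauchy_product_sums) (rule sqrt1m_sums(2)[OF z])+
  also have "suminf ?f = sqrt1m z"
    using sqrt1m_sums(1)[OF z] by (rule sums_unique[symmetric])
  also have "(\<lambda>n. \<Sum>i\<le>n. ?f i * ?f (n - i)) =
      (\<lambda>n. if n \<in> {0, 1} then (if n = 0 then 1 else - z) else 0)"
  proof
    fix n
    have "(\<Sum>i\<le>n. ?f i * ?f (n - i)) = (\<Sum>i\<le>n. sqrt_coeff i * sqrt_coeff (n - i)) *\<^sub>R z ^ n"
      by (subst scaleR_sum_left, intro sum.cong) (auto simp flip: power_add)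
    then show "(\<Sum>i\<le>n. ?f i * ?f (n - i)) = (if n \<in> {0, 1} then (if n = 0 then 1 else - z) else 0)"
      by (auto simp: sqrt_coeff_convolution)
  qed
  finally have "(\<lambda>n. if n \<in> {0, 1} then (if n = 0 then 1 else - z) else 0) sums (sqrt1m z * sqrt1m z)" .
  moreover have "(\<lambda>n. if n \<in> {0, 1} then (if n = 0 then 1 else - z) else 0) sums
      (\<Sum>n\<in>{0, 1::nat}. if n = 0 then 1 else - z)"
    by (rule sums_If_finite_set) simp
  ultimately show ?thesis using sums_unique2 by fastforce
qed

lemma bounded_linear_star: "bounded_linear (star :: 'a::cstar_algebra \<Rightarrow> 'a)"
proof (rule bounded_linear_intro[of _ 1])
  show "star (r *\<^sub>R x) = r *\<^sub>R star x" for r and x :: 'a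
    by (simp add: star_scaleC flip: scaleC_of_real)
qed (auto simp: star_add norm_star)

lemmas star_scaleR = linear_cmul[OF bounded_linear.linear[OF bounded_linear_star]]
lemmas star_sum = linear_sum[OF bounded_linear.linear[OF bounded_linear_star]]
lemmas star_minus = linear_neg[OF bounded_linear.linear[OF bounded_linear_star]]
lemmas star_0 = linear_0[OF bounded_linear.linear[OF bounded_linear_star]]

lemma star_1 [simp]: "star (1::'a::cstar_algebra) = 1"
  by (metis mult_1 mult_1_right star_mult star_star)

lemma star_power: "star (x ^ n) = star (x::'a::cstar_algebra) ^ n"
  by (induction n) (simp_all add: star_mult power_commutes)

lemma sqrt_rem_commute:
  fixes z :: "'a::cstar_algebra"
  assumes "norm z \<le> 1" "c * z = z * c"
  shows "c * sqrt_rem z = sqrt_rem z * c"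
proof -
  have "c * z ^ n = z ^ n * c" for n
    by (induction n) (simp_all add: mult.assoc, metis assms(2) mult.assoc)
  then have "c * (\<Sum>n. sqrt_coeff (Suc n) *\<^sub>R z ^ Suc n) = (\<Sum>n. sqrt_coeff (Suc n) *\<^sub>R z ^ Suc n) * c"
    using suminf_mult[OF summable_norm_cancel[OF summable_sqrt_rem[OF assms(1)]], of c]
      suminf_mult2[OF summable_norm_cancel[OF summable_sqrt_rem[OF assms(1)]], of c]
    by (simp del: power_Suc)
  then show ?thesis by (simp add: sqrt_rem_def)
qed

lemma sqrt_rem_self_adjoint:
  fixes z :: "'a::cstar_algebra"
  assumes "norm z \<le> 1" "self_adjoint z"
  shows "self_adjoint (sqrt_rem z)"
  unfolding self_adjoint_def sqrt_rem_def star_minus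
  using bounded_linear.suminf[OF bounded_linear_star summable_norm_cancel[OF summable_sqrt_rem[OF assms(1)]]]
    assms(2)
  by (simp add: star_scaleR star_power self_adjoint_def del: power_Suc)

text \<open>The series of \<open>sqrt_rem\<close> has no constant term. This later lets a corrected
  projection keep exact orthogonality.\<close>

lemma sqrt_rem_annihilate:
  fixes z :: "'a::cstar_algebra"
  assumes "norm z \<le> 1" "z * q = 0"
  shows "sqrt_rem z * q = 0"
proof -
  have "z ^ Suc n * q = 0" for n
    using assms(2) by (induction n) (simp_all add: mult.assoc)
  then show ?thesis
    using suminf_mult2[OF summable_norm_cancel[OF summable_sqrt_rem[OF assms(1)]], of q]
    by (simp add: sqrt_rem_def del: power_Suc)
qed

lemma sqrt1m_commute:
  "norm z \<le> 1 \<Longrightarrow> c * z = z * c \<Longrightarrow> c * sqrt1m z = sqrt1m z * (c :: 'a::cstar_algebra)"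
  by (simp add: sqrt1m_def algebra_simps sqrt_rem_commute)

lemma sqrt1m_self_adjoint:
  "norm z \<le> 1 \<Longrightarrow> self_adjoint z \<Longrightarrow> self_adjoint (sqrt1m (z :: 'a::cstar_algebra))"
  using sqrt_rem_self_adjoint[of z] by (simp add: sqrt1m_def self_adjoint_def star_diff)

lemma scaleC_commute_scaleR: "c *\<^sub>C (r *\<^sub>R x) = r *\<^sub>R (c *\<^sub>C (x::'a::cstar_algebra))"
  by (simp add: scaleC_scaleC mult.commute flip: scaleC_of_real)

lemma scaleC_zero_right [simp]: "c *\<^sub>C (0::'a::cstar_algebra) = 0"
  by (metis add_cancel_right_right scaleC_add_right)

lemma scaleC_zero_left [simp]: "0 *\<^sub>C (x::'a::cstar_algebra) = 0"
  using scaleC_of_real[of 0 x] by simp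

lemma scaleC_one [simp]: "1 *\<^sub>C (x::'a::cstar_algebra) = x"
  using scaleC_of_real[of 1 x] by simp

lemma scaleC_minus_left: "(- c) *\<^sub>C x = - (c *\<^sub>C (x::'a::cstar_algebra))"
  by (metis mult_minus1 scaleC_scaleC scaleC_uminus)

text \<open>Up to a scalar, \<open>x + iy\<close> is unitary.\<close>

lemma norm_commuting_squares:
  fixes x y :: "'a::cstar_algebra"
  assumes sa: "self_adjoint x" "self_adjoint y" and comm: "x * y = y * x"
    and sum: "x * x + y * y = K *\<^sub>R 1" and K: "K \<ge> 0"
  shows "(norm x)\<^sup>2 \<le> K"
proof -
  define u where "u = x + \<i> *\<^sub>C y"
  have su: "star u = x - \<i> *\<^sub>C y"
    using sa by (simp add: u_def star_add star_scaleC self_adjoint_def scaleC_minus_left)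
  have "star u * u = x * x + y * y"
    by (simp add: su) (simp add: u_def algebra_simps mult_scaleC_left mult_scaleC_right comm scaleC_scaleC
        scaleC_minus_left scaleC_diff_right)
  then have "(norm u)\<^sup>2 = K"
    using K by (simp add: sum flip: cstar_identity)
  then have nu: "norm u = sqrt K"
    by (metis norm_ge_zero real_sqrt_unique)
  have "2 *\<^sub>R x = u + star u"
    by (simp add: su) (simp add: u_def scaleR_2)
  then have "2 * norm x \<le> norm u + norm (star u)"
    by (metis abs_numeral norm_scaleR norm_triangle_ineq)
  then have "norm x \<le> sqrt K" by (simp add: norm_star nu)
  then show ?thesis using K by (metis norm_ge_zero power_mono real_sqrt_pow2)
qed

text \<open>The triangle inequality gives only \<open>2\<close>. With
  \<open>y = sqrt (1 - x * x)\<close> the squares of \<open>x\<close> and \<open>y\<close> add up to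
  \<open>1\<close>, so \<open>y\<close> is a contraction, and \<open>y * y\<close> is the element in
  question. This makes \<open>1 - x * x\<close> an admissible argument of the series.\<close>

lemma norm_one_minus_square:
  fixes x :: "'a::cstar_algebra"
  assumes sa: "self_adjoint x" and x: "norm x \<le> 1"
  shows "norm (1 - x * x) \<le> 1"
proof -
  have n: "norm (x * x) \<le> 1"
    using norm_mult_ineq[of x x] x by (meson mult_le_one norm_ge_zero order_trans)
  have sa2: "self_adjoint (x * x)"
    using sa by (simp add: self_adjoint_def star_mult)
  let ?y = "sqrt1m (x * x)"
  have yy: "?y * ?y = 1 - x * x" by (rule sqrt1m_square[OF n])
  have "(norm ?y)\<^sup>2 \<le> 1"
  proof (rule norm_commuting_squares)
    show "self_adjoint ?y" using n sa2 by (rule sqrt1m_self_adjoint)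
    show "?y * x = x * ?y" by (rule sqrt1m_commute[OF n, symmetric]) (simp add: mult.assoc)
  qed (auto simp: sa yy)
  then show ?thesis
    using norm_mult_ineq[of ?y ?y] by (simp add: yy power2_eq_square)
qed

text \<open>\<open>m\<close> is \<open>|w|\<close> and \<open>k\<close> its square root. After
  normalisation \<open>|v| = sqrt (1 - z)\<close> with \<open>z = 1 - v * v\<close>; moreover
  \<open>|v| = 1 - r\<close> with \<open>r\<close> again in the unit ball, so a second use of the
  series yields the root. The clauses about \<open>c\<close> stand in for functional
  calculus.\<close>

lemma abs_exists:
  fixes w :: "'a::cstar_algebra"
  assumes sa: "self_adjoint w"
  obtains m k where "self_adjoint m" "self_adjoint k" "m * m = w * w" "k * k = m"
    "\<And>c. c * w = w * c \<Longrightarrow> c * m = m * c" "\<And>c. c * w = w * c \<Longrightarrow> c * k = k * c"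
proof (cases "w = 0")
  case True
  then show ?thesis using that[of 0 0] by (simp add: self_adjoint_def star_0)
next
  case False
  let ?N = "norm w"
  have N: "?N > 0" using False by simp
  define v where "v = (1 / ?N) *\<^sub>R w"
  have v: "self_adjoint v" "norm v \<le> 1"
    using sa False by (auto simp: v_def self_adjoint_def star_scaleR)
  define z where "z = 1 - v * v"
  have z: "norm z \<le> 1" "self_adjoint z"
    using norm_one_minus_square[OF v] v by (auto simp: z_def self_adjoint_def star_diff star_mult)
  define r where "r = sqrt_rem z"
  have r: "norm r \<le> 1" "self_adjoint r"
    using norm_sqrt_rem[OF z(1)] z sqrt_rem_self_adjoint[OF z] by (auto simp: r_def)
  define m where "m = ?N *\<^sub>R sqrt1m z"
  define k where "k = sqrt ?N *\<^sub>R sqrt1m r"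
  show ?thesis
  proof (rule that[of m k])
    show "self_adjoint m" "self_adjoint k"
      using sqrt1m_self_adjoint[OF z] sqrt1m_self_adjoint[OF r]
      by (auto simp: m_def k_def self_adjoint_def star_scaleR)
    show "m * m = w * w"
      using N by (simp add: m_def sqrt1m_square[OF z(1)]) (simp add: z_def v_def)
    show "k * k = m"
      using N by (simp add: k_def m_def sqrt1m_square[OF r(1)]) (simp add: sqrt1m_def r_def)
    fix c assume c: "c * w = w * c"
    then have "c * v = v * c" by (simp add: v_def)
    then have "c * z = z * c"
      by (simp add: z_def algebra_simps) (metis mult.assoc)
    then show "c * m = m * c" "c * k = k * c"
      using sqrt1m_commute[OF z(1), of c] sqrt1m_commute[OF r(1), of c] sqrt_rem_commute[OF z(1), of c]
      by (auto simp: m_def k_def r_def)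
  qed
qed

subsection \<open>Inverses, signs and projections\<close>

lemma inverse_near_one:
  fixes v :: "'a::cstar_algebra"
  assumes "norm (1 - v) \<le> 1 / 2"
  obtains w where "w * v = 1" "v * w = 1" "norm w \<le> 2"
proof -
  let ?z = "1 - v"
  have s: "summable (\<lambda>n. ?z ^ n)"
    using assms by (intro complete_algebra_summable_geometric) simp
  let ?w = "\<Sum>n. ?z ^ n"
  have shift: "(\<Sum>n. ?z ^ Suc n) = ?w - 1"
    using suminf_split_head[OF s] by simp
  have "?z * ?w = ?w - 1"
    using suminf_mult[OF s, of ?z] shift by simp
  then have 1: "v * ?w = 1" by (simp add: algebra_simps)
  have "?w * ?z = ?w - 1"
    using suminf_mult2[OF s, of ?z] shift by (simp add: power_commutes)
  then have 2: "?w * v = 1" by (simp add: algebra_simps)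
  have "norm ?w = norm (1 + ?z * ?w)"
    using 1 by (simp add: algebra_simps)
  also have "\<dots> \<le> 1 + norm ?z * norm ?w"
    by (metis add_left_mono norm_mult_ineq norm_one norm_triangle_le)
  also have "\<dots> \<le> 1 + 1 / 2 * norm ?w"
    using assms by (intro add_left_mono mult_right_mono) auto
  finally show ?thesis using that[OF 2 1] by simp
qed

lemma inverse_commute:
  fixes Y :: "'a::monoid_mult"
  assumes "v * Y = 1" "Y * v = 1" "c * Y = Y * c"
  shows "c * v = v * c"
proof -
  have "c * v = v * (Y * c) * v" using assms(1) by (simp flip: mult.assoc)
  also have "\<dots> = v * c * (Y * v)" using assms(3) by (simp add: mult.assoc flip: assms(3))
  finally show ?thesis using assms(2) by simp
qed

lemma self_adjoint_inverse:
  fixes Y :: "'a::cstar_algebra"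
  assumes "v * Y = 1" "Y * v = 1" "self_adjoint Y"
  shows "self_adjoint v"
proof -
  have "star v * Y = 1"
    using assms(2,3) star_mult[of Y v] by (simp add: self_adjoint_def)
  then have "star v * (Y * v) = v" by (simp flip: mult.assoc)
  then have "star v = v" by (simp add: assms(2))
  then show ?thesis by (simp add: self_adjoint_def)
qed

text \<open>\<open>S\<close> is the symmetry of the polar decomposition, \<open>|Y|\<close> times
  the inverse of \<open>Y\<close>; invertibility keeps it inside the algebra. The root
  \<open>k\<close> of \<open>|Y|\<close> is recorded because later estimates need \<open>|Y|\<close>
  as a square.\<close>

lemma sign_exists:
  fixes Y :: "'a::cstar_algebra"
  assumes sa: "self_adjoint Y" and inv: "invertible_element Y"
  obtains S k where "self_adjoint S" "self_adjoint k" "S * S = 1" "Y * S = k * k"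
    "\<And>c. c * Y = Y * c \<Longrightarrow> c * S = S * c" "\<And>c. c * Y = Y * c \<Longrightarrow> c * k = k * c"
proof -
  obtain v where v: "v * Y = 1" "Y * v = 1"
    using inv by (auto simp: invertible_element_def)
  obtain m k where mk: "self_adjoint m" "self_adjoint k" "m * m = Y * Y" "k * k = m"
    "\<And>c. c * Y = Y * c \<Longrightarrow> c * m = m * c" "\<And>c. c * Y = Y * c \<Longrightarrow> c * k = k * c"
    using abs_exists[OF sa] by blast
  have vsa: "self_adjoint v" by (rule self_adjoint_inverse[OF v sa])
  have "v * Y = Y * v" using v by simp
  then have vm: "v * m = m * v" by (rule mk(5))
  show ?thesis
  proof (rule that[of "m * v" k])
    show "self_adjoint (m * v)"
      using mk(1) vsa vm by (simp add: self_adjoint_def star_mult)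
    have "m * v * (m * v) = m * m * v * v" by (metis vm mult.assoc)
    then show "m * v * (m * v) = 1" by (metis mk(3) v(2) mult.assoc mult_1_right)
    show "Y * (m * v) = k * k"
      using mk(5)[of Y] by (metis mk(4) v(2) mult.assoc mult_1_right)
    show "c * (m * v) = m * v * c" if "c * Y = Y * c" for c
      using mk(5)[OF that] inverse_commute[OF v that] by (metis mult.assoc)
  qed (fact mk)+
qed

definition projection :: "'a::cstar_algebra \<Rightarrow> bool" where
  "projection p \<longleftrightarrow> self_adjoint p \<and> p * p = p"

lemma projection_one: "projection 1"
  by (simp add: projection_def self_adjoint_def)

lemma projection_zero: "projection 0"
  by (simp add: projection_def self_adjoint_def star_0)

lemma projection_diff:
  "projection e \<Longrightarrow> projection f \<Longrightarrow> e * f = f \<Longrightarrow> projection (e - f)"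
  unfolding projection_def self_adjoint_def
  by (auto simp: star_diff algebra_simps) (metis star_mult)

lemma projection_compl: "projection e \<Longrightarrow> projection (1 - e)"
  by (rule projection_diff[OF projection_one]) auto

lemma norm_projection_cases:
  assumes "projection p"
  shows "norm p = 0 \<or> norm p = 1"
proof -
  have "norm p = (norm p)\<^sup>2"
    using assms cstar_identity[of p] by (simp add: projection_def self_adjoint_def)
  then show ?thesis by (simp add: power2_eq_square)
qed

lemma norm_projection_le: "projection p \<Longrightarrow> norm p \<le> 1"
  using norm_projection_cases by fastforce

lemma norm_compress:
  "projection p \<Longrightarrow> projection q \<Longrightarrow> norm (p * x * q) \<le> norm (x::'a::cstar_algebra)"
proof -
  assume p: "projection p" and q: "projection q"
  have "norm (p * x * q) \<le> norm p * norm x * norm q"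
    by (meson mult_right_mono norm_ge_zero norm_mult_ineq order_trans)
  also have "\<dots> \<le> 1 * norm x * 1"
    using norm_projection_le[OF p] norm_projection_le[OF q] by (intro mult_mono) auto
  finally show ?thesis by simp
qed

lemma norm_symmetry:
  "self_adjoint S \<Longrightarrow> S * S = 1 \<Longrightarrow> norm (S::'a::cstar_algebra) = 1"
  using cstar_identity[of S] by (simp add: self_adjoint_def power2_eq_1_iff)
    (smt (verit) norm_ge_zero)

text \<open>If \<open>w\<close> were a projection, \<open>y = 2 w - 1\<close> would be a symmetry.
  Here \<open>y\<close> is replaced by the symmetry \<open>S\<close> of its polar decomposition, and
  \<open>p = (1 + S) / 2\<close>. The bound \<open>1 / 8\<close> gives
  \<open>norm z \<le> 1 / 2\<close>, so that \<open>g = |y|\<close> is invertible by a Neumann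
  series.\<close>

lemma near_projection:
  fixes w :: "'a::cstar_algebra"
  assumes sa: "self_adjoint w" and small: "norm (w * w - w) \<le> 1 / 8"
  obtains p where "projection p" "norm (p - w) \<le> 2 * norm (w * w - w)"
    "\<And>q. w * q = 0 \<Longrightarrow> p * q = 0"
proof -
  define y where "y = w + w - 1"
  define z where "z = 1 - y * y"
  have z4: "z = 4 *\<^sub>R (w - w * w)"
  proof -
    have "4 *\<^sub>R x = x + x + (x + x)" for x :: 'a
      using scaleR_left_distrib[of 2 2 x] by (simp add: scaleR_2)
    then show ?thesis by (simp add: z_def y_def algebra_simps del: scaleR_left_distrib)
  qed
  have nz: "norm z = 4 * norm (w * w - w)"
    by (simp add: z4 norm_minus_commute)
  then have z: "norm z \<le> 1 / 2" using small by simp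
  have sy: "self_adjoint y" and sz: "self_adjoint z"
    using sa by (auto simp: y_def z_def self_adjoint_def star_diff star_add star_mult)
  define g where "g = sqrt1m z"
  have g1: "1 - g = sqrt_rem z" by (simp add: g_def sqrt1m_def)
  have ng: "norm (1 - g) \<le> norm z" unfolding g1 using z by (intro norm_sqrt_rem) simp
  then obtain h where h: "h * g = 1" "g * h = 1"
    using z by (meson inverse_near_one order_trans)
  have gg: "g * g = y * y" using sqrt1m_square[of z] z by (simp add: g_def z_def)
  have sg: "self_adjoint g" unfolding g_def using z by (intro sqrt1m_self_adjoint sz) simp
  have "y * g = g * y"
    unfolding g_def using z by (intro sqrt1m_commute) (simp_all add: z_def algebra_simps)
  then have yh: "y * h = h * y" by (rule inverse_commute[OF h])
  have sh: "self_adjoint h" by (rule self_adjoint_inverse[OF h sg])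
  define S where "S = y * h"
  have sS: "self_adjoint S"
    using sy sh yh by (simp add: S_def self_adjoint_def star_mult)
  have "S * S = y * y * h * h" by (simp add: S_def) (metis yh mult.assoc)
  then have SS: "S * S = 1"
    unfolding gg[symmetric] by (metis h(2) mult.assoc mult_1_right)
  have Sg: "S * g = y" by (simp add: S_def mult.assoc h)
  have "S - y = S * (1 - g)" by (simp add: algebra_simps Sg)
  then have "norm (S - y) \<le> norm z"
    using norm_mult_ineq[of S "1 - g"] ng norm_symmetry[OF sS SS] by simp
  moreover define p where "p = (1 / 2) *\<^sub>R (1 + S)"
  have "p - w = (1 / 2) *\<^sub>R (S - y)"
    by (simp add: p_def y_def scaleR_right_distrib scaleR_right_diff_distrib flip: scaleR_left_distrib)
  ultimately have "norm (p - w) \<le> 2 * norm (w * w - w)" by (simp add: nz)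
  moreover have "projection p"
  proof -
    have "(1 + S) * (1 + S) = 2 *\<^sub>R (1 + S)"
      by (simp add: distrib_left distrib_right SS scaleR_2)
    then have "p * p = p" by (simp add: p_def)
    then show ?thesis
      using sS by (simp add: projection_def self_adjoint_def p_def star_scaleR star_add)
  qed
  \<comment> \<open>On \<open>q\<close> one has \<open>w = 0\<close>, hence \<open>y = -1\<close>,
    \<open>z = 0\<close> and \<open>g = 1\<close>; so \<open>S = -1\<close> there and
    \<open>p\<close> vanishes.\<close>
  moreover have "p * q = 0" if "w * q = 0" for q
  proof -
    have "z * q = 0" by (simp add: z4 left_diff_distrib mult.assoc that)
    then have "(1 - g) * q = 0" unfolding g1 using z by (intro sqrt_rem_annihilate) auto
    then have "h * q = q" by (metis h(1) eq_iff_diff_eq_0 left_diff_distrib mult.assoc mult_1)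
    then have "S * q = - q" by (simp add: S_def mult.assoc) (simp add: y_def left_diff_distrib distrib_right that)
    then show ?thesis by (simp add: p_def distrib_right)
  qed
  ultimately show ?thesis using that by blast
qed

text \<open>Schur complement: conjugating by a unipotent element makes \<open>y\<close> block diagonal.\<close>

lemma commuting_invertible:
  fixes e h y :: "'a::cstar_algebra"
  assumes e: "projection e" and h: "e * h = h" "h * e = h"
    and y: "self_adjoint y" "invertible_element y"
    and near: "norm (y - (h + (1 - e))) \<le> \<eta>" and \<eta>: "\<eta> \<le> 1 / 2"
  obtains Y where "self_adjoint Y" "invertible_element Y" "e * Y = Y * e" "norm (e * Y - h) \<le> 2 * \<eta>"
proof -
  define f where "f = 1 - e"
  define d where "d = y - (h + f)"
  have d: "norm d \<le> \<eta>" using near by (simp add: d_def f_def)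
  have e': "e * e = e" "star e = e" using e by (auto simp: projection_def self_adjoint_def)
  have f: "projection f" unfolding f_def by (rule projection_compl[OF e])
  have f': "f * f = f" "star f = f" using f by (auto simp: projection_def self_adjoint_def)
  have ef: "e * f = 0" "f * e = 0" by (auto simp: f_def algebra_simps e')
  have fh: "f * h = 0" "h * f = 0" by (auto simp: f_def algebra_simps h)
  have efx: "f * (f * x) = f * x" "e * (e * x) = e * x" "e * (f * x) = 0" "f * (e * x) = 0"
    "f * (h * x) = 0" "h * (f * x) = 0" "e * (h * x) = h * x" "h * (e * x) = h * x" for x
    by (simp_all add: ef e' f' fh h flip: mult.assoc)
  note blocks = ef e' f' fh h efx distrib_left distrib_right left_diff_distrib right_diff_distrib mult.assoc
  have sy: "star y = y" using y by (simp add: self_adjoint_def)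
  \<comment> \<open>Adding \<open>e\<close> makes the \<open>f\<close> corner of \<open>y\<close>
    invertible in the whole algebra; it is close to \<open>f\<close> because \<open>h\<close> has no
    part there.\<close>
  define v where "v = f * y * f + e"
  have "1 - v = f - f * y * f" by (simp add: v_def f_def)
  then have "1 - v = - (f * d * f)" by (simp add: d_def blocks)
  then have "norm (1 - v) \<le> 1 / 2"
    using norm_compress[OF f f, of d] d \<eta> by simp
  then obtain w where w: "w * v = 1" "v * w = 1" "norm w \<le> 2"
    using inverse_near_one by blast
  have "f * v = f * y * f" "v * f = f * y * f"
    by (simp_all add: v_def blocks)
  then have "f * w = w * f" by (intro inverse_commute[OF w(1,2)]) simp
  note fw = this
  have sv: "self_adjoint v"
    by (simp add: v_def self_adjoint_def star_add star_mult sy f' e' mult.assoc)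
  have "self_adjoint w" by (rule self_adjoint_inverse[OF w(1,2) sv])
  then have sw: "star w = w" by (simp add: self_adjoint_def)
  \<comment> \<open>\<open>n\<close> is the inverse of the \<open>f\<close> corner times the lower
    left block \<open>f * y * e\<close>; conjugating by \<open>1 - n\<close> clears that block, and
    by self-adjointness also the opposite one.\<close>
  define n where "n = w * f * y * e"
  have nn: "n * n = 0"
  proof -
    have "n * n = w * f * y * (e * (w * f)) * y * e" by (simp add: n_def mult.assoc)
    also have "e * (w * f) = 0" by (metis ef(1) fw mult.assoc mult_zero_left)
    finally show ?thesis by simp
  qed
  define g where "g = 1 - n"
  have g: "(1 + n) * g = 1" "g * (1 + n) = 1" by (auto simp: g_def algebra_simps nn)
  define Y where "Y = star g * y * g"
  have sY: "self_adjoint Y" by (simp add: Y_def self_adjoint_def star_mult star_star sy mult.assoc)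
  obtain u where u: "u * y = 1" "y * u = 1" using y(2) by (auto simp: invertible_element_def)
  have sg: "star (1 + n) * star g = 1" "star g * star (1 + n) = 1"
    using g by (simp_all flip: star_mult)
  have Yu: "Y * ((1 + n) * u * star (1 + n)) = 1" "((1 + n) * u * star (1 + n)) * Y = 1"
  proof -
    have "Y * ((1 + n) * u * star (1 + n)) = star g * y * (g * (1 + n)) * u * star (1 + n)"
      by (simp only: Y_def mult.assoc)
    also have "\<dots> = star g * (y * u) * star (1 + n)" by (simp only: g mult_1_right mult.assoc)
    finally show "Y * ((1 + n) * u * star (1 + n)) = 1" by (simp only: u sg mult_1_right)
    have "((1 + n) * u * star (1 + n)) * Y = (1 + n) * u * (star (1 + n) * star g) * y * g"
      by (simp only: Y_def mult.assoc)
    also have "\<dots> = (1 + n) * (u * y) * g" by (simp only: sg mult_1_right mult.assoc)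
    finally show "((1 + n) * u * star (1 + n)) * Y = 1" by (simp only: u g mult_1_right)
  qed
  have invY: "invertible_element Y" using Yu by (auto simp: invertible_element_def)
  have ge: "g * e = e - n" by (simp add: g_def n_def blocks)
  have fn: "f * n = n" by (simp add: n_def flip: mult.assoc) (metis fw f'(1) mult.assoc)
  have "f * y * n = f * y * f * n" by (simp add: fn mult.assoc)
  also have "\<dots> = (f * v) * n" using \<open>f * v = f * y * f\<close> by simp
  also have "\<dots> = f * (v * w) * f * y * e" by (simp add: n_def mult.assoc)
  also have "\<dots> = f * y * e" by (simp add: w blocks)
  finally have fyn: "f * y * n = f * y * e" .
  have fyge: "f * y * (g * e) = 0" by (simp add: ge algebra_simps) (metis fyn mult.assoc)
  have sn: "star n = e * y * f * w" by (simp add: n_def star_mult sy f' e' sw mult.assoc)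
  have snf: "star n * f = star n" unfolding sn by (metis fw f'(1) mult.assoc)
  have sne: "star n * e = 0" by (metis snf ef(2) mult.assoc mult_zero_right)
  have fg: "f * star g = f"
  proof -
    have "f * star n = 0" unfolding sn by (metis ef(2) mult.assoc mult_zero_left)
    then show ?thesis by (simp add: g_def star_diff algebra_simps)
  qed
  have "f * Y * e = f * star g * y * (g * e)" by (simp add: Y_def mult.assoc)
  then have fYe: "f * Y * e = 0" by (simp add: fg fyge)
  then have "star (f * Y * e) = 0" by (simp add: star_0)
  then have eYf: "e * Y * f = 0"
    using sY by (simp add: star_mult f' e' self_adjoint_def mult.assoc)
  have eYe1: "Y * e = e * Y * e" using fYe by (simp add: f_def algebra_simps)
  have eYe2: "e * Y = e * Y * e" using eYf unfolding f_def right_diff_distrib mult_1_right by (rule eq_iff_diff_eq_0[THEN iffD2])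
  have comm: "e * Y = Y * e" by (rule trans[OF eYe2 eYe1[symmetric]])
  have yge: "y * (g * e) = e * y * (g * e)" using fyge by (simp add: f_def algebra_simps)
  have "e * Y * e = star (g * e) * (y * (g * e))"
    by (simp add: Y_def star_mult e' mult.assoc)
  also have "\<dots> = (star (g * e) * e) * y * (g * e)" by (subst yge) (simp add: mult.assoc)
  also have "star (g * e) * e = e" by (simp add: ge star_diff e' algebra_simps sne)
  finally have eYe3: "e * Y * e = e * y * e - e * y * n" by (simp add: ge algebra_simps)
  have fye: "f * y * e = f * d * e"
    by (simp add: d_def blocks)
  have eyf: "e * y * f = e * d * f"
    by (simp add: d_def blocks)
  have "e * y * n = e * y * (f * n)" by (simp add: fn)
  also have "\<dots> = (e * y * f) * w * (f * y * e)" by (simp add: n_def mult.assoc)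
  also have "\<dots> = (e * d * f) * w * (f * d * e)" by (simp only: fye eyf)
  finally have eyn: "e * y * n = (e * d * f) * w * (f * d * e)" .
  \<comment> \<open>The correction is a product of two off-diagonal blocks of norm at most
    \<open>\<eta>\<close> around \<open>w\<close> of norm at most \<open>2\<close>; as
    \<open>\<eta> \<le> 1 / 2\<close>, it is at most \<open>\<eta>\<close>.\<close>
  have "norm (e * y * n) \<le> norm (e * d * f) * norm w * norm (f * d * e)"
    unfolding eyn by (meson mult_right_mono norm_ge_zero norm_mult_ineq order_trans)
  also have "\<dots> \<le> \<eta> * 2 * (1 / 2)"
    using norm_compress[OF e f, of d] norm_compress[OF f e, of d] d \<eta> w(3) order_trans[OF norm_ge_zero d]
    by (intro mult_mono) auto
  finally have 1: "norm (e * y * n) \<le> \<eta>" by simp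
  have "e * y * e - h = e * d * e"
    by (simp add: d_def blocks)
  then have 2: "norm (e * y * e - h) \<le> \<eta>" using norm_compress[OF e e, of d] d by simp
  have "e * Y - h = (e * y * e - h) - e * y * n"
    by (simp add: trans[OF eYe2 eYe3])
  then have "norm (e * Y - h) \<le> 2 * \<eta>"
    using 1 2 norm_triangle_ineq4[of "e * y * e - h" "e * y * n"] by (metis add_mono mult_2 order_trans)
  then show ?thesis using that sY invY comm by blast
qed

subsection \<open>Recovering the norm from a state\<close>

locale cstar_state =
  fixes \<tau> :: "'a::cstar_algebra \<Rightarrow> complex"
  assumes state: "state \<tau>"
begin

lemma add: "\<tau> (x + y) = \<tau> x + \<tau> y"
  and scaleC: "\<tau> (c *\<^sub>C x) = c * \<tau> x"
  and pos: "\<tau> (star x * x) \<in> \<real>\<^sub>\<ge>\<^sub>0"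
  and one: "\<tau> 1 = 1"
  using state by (auto simp: state_def)

lemma Re_pos: "Re (\<tau> (star x * x)) \<ge> 0"
  and Im_pos: "Im (\<tau> (star x * x)) = 0"
  using pos[of x] by (auto simp: complex_nonneg_Reals_iff)

lemma zero: "\<tau> 0 = 0"
  using scaleC[of 0 0] by simp

lemma scaleR: "\<tau> (r *\<^sub>R x) = r *\<^sub>R \<tau> x"
  using scaleC[of "of_real r" x] by (simp add: scaleC_of_real scaleR_conv_of_real)

lemma minus: "\<tau> (- x) = - \<tau> x"
  using scaleR[of "-1" x] by simp

lemma diff: "\<tau> (x - y) = \<tau> x - \<tau> y"
  using add[of x "- y"] by (simp add: minus)

lemma hermitian: "\<tau> (star x) = cnj (\<tau> x)"
proof -
  have "Im (\<tau> (star (1 + c *\<^sub>C x) * (1 + c *\<^sub>C x))) = 0" for c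
    by (rule Im_pos)
  moreover have "star (1 + c *\<^sub>C x) * (1 + c *\<^sub>C x) =
      1 + c *\<^sub>C x + cnj c *\<^sub>C star x + (cnj c * c) *\<^sub>C (star x * x)" for c
    by (simp add: star_add star_scaleC mult_scaleC_left mult_scaleC_right distrib_left distrib_right
        scaleC_add_right scaleC_scaleC ac_simps)
  ultimately have "Im (1 + c * \<tau> x + cnj c * \<tau> (star x) + (cnj c * c) * \<tau> (star x * x)) = 0" for c
    by (simp add: add scaleC one)
  from this[of 1] this[of \<i>] show ?thesis
    by (auto simp: complex_eq_iff Im_pos)
qed

definition seminorm :: "'a \<Rightarrow> real" where
  "seminorm x = sqrt (Re (\<tau> (star x * x)))"

lemma seminorm_nonneg [simp]: "seminorm x \<ge> 0"
  by (simp add: seminorm_def Re_pos)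

lemma seminorm_square: "(seminorm x)\<^sup>2 = Re (\<tau> (star x * x))"
  by (simp add: seminorm_def Re_pos)

lemma square_eq_seminorm: "\<tau> (star x * x) = of_real ((seminorm x)\<^sup>2)"
  by (simp add: seminorm_square complex_eq_iff Im_pos)

lemma Cauchy_Schwarz: "cmod (\<tau> (star y * x)) \<le> seminorm y * seminorm x"
proof (cases "seminorm x = 0")
  case True
  then show ?thesis
    using state_null(1)[OF state, of x y] square_eq_seminorm[of x] by simp
next
  case False
  let ?p = "\<tau> (star y * x)" and ?q = "(seminorm x)\<^sup>2"
  have q: "?q > 0" using False by simp
  have "star (star y * x) = star x * y" by (simp add: star_mult star_star)
  then have p': "\<tau> (star x * y) = cnj ?p" using hermitian[of "star y * x"] by simp
  have *: "star (y + c *\<^sub>C x) * (y + c *\<^sub>C x) =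
        star y * y + c *\<^sub>C (star y * x) + cnj c *\<^sub>C (star x * y) + (cnj c * c) *\<^sub>C (star x * x)" for c
    by (simp add: star_add star_scaleC mult_scaleC_left mult_scaleC_right distrib_left distrib_right
        scaleC_add_right scaleC_scaleC ac_simps)
  \<comment> \<open>The coefficient that minimises
    \<open>seminorm (y + c *\<^sub>C x)\<close>.\<close>
  define c where "c = - (cnj ?p / of_real ?q)"
  have "\<tau> (star (y + c *\<^sub>C x) * (y + c *\<^sub>C x)) =
      of_real ((seminorm y)\<^sup>2) + c * ?p + cnj c * cnj ?p + cnj c * c * of_real ?q"
    unfolding * by (simp add: add scaleC p' square_eq_seminorm)
  also have "c * ?p = - of_real ((cmod ?p)\<^sup>2 / ?q)"
    by (simp add: c_def complex_norm_square mult.commute del: of_real_power)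
  also have "cnj c * cnj ?p = - of_real ((cmod ?p)\<^sup>2 / ?q)"
    by (simp add: c_def complex_norm_square del: of_real_power)
  also have "cnj c * c * of_real ?q = of_real ((cmod ?p)\<^sup>2 / ?q)"
    using q by (simp add: c_def complex_norm_square del: of_real_power)
  finally have "(seminorm y)\<^sup>2 - (cmod ?p)\<^sup>2 / ?q \<ge> 0"
    using Re_pos[of "y + c *\<^sub>C x"] by (simp del: of_real_power)
  then have "(cmod ?p)\<^sup>2 \<le> (seminorm y * seminorm x)\<^sup>2"
    using q by (simp add: field_simps power_mult_distrib)
  then show ?thesis by (simp add: power2_le_iff_abs_le)
qed

text \<open>For nonzero \<open>k\<close>, the element \<open>norm k - k\<close> is
  \<open>norm k\<close> times the square of \<open>sqrt1m z\<close>, so sandwiching it by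
  \<open>y\<close> gives nonnegative state.\<close>

lemma sandwich_le:
  assumes "self_adjoint k"
  shows "Re (\<tau> (star y * k * y)) \<le> norm k * (seminorm y)\<^sup>2"
proof (cases "k = 0")
  case False
  define z where "z = (1 / norm k) *\<^sub>R k"
  have z: "norm z \<le> 1" "self_adjoint z"
    using assms False by (auto simp: z_def self_adjoint_def star_scaleR)
  have g: "star (sqrt1m z) = sqrt1m z"
    using sqrt1m_self_adjoint[OF z] by (simp add: self_adjoint_def)
  have "star (sqrt1m z * y) * (sqrt1m z * y) = star y * (sqrt1m z * sqrt1m z) * y"
    by (simp add: star_mult g mult.assoc)
  also have "\<dots> = star y * y - (1 / norm k) *\<^sub>R (star y * k * y)"
    unfolding sqrt1m_square[OF z(1)] by (simp add: z_def left_diff_distrib right_diff_distrib)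
  finally have "0 \<le> Re (\<tau> (star y * y - (1 / norm k) *\<^sub>R (star y * k * y)))"
    by (metis Re_pos)
  then show ?thesis
    using False by (simp add: diff scaleR seminorm_square field_simps)
qed (simp add: zero)

lemma seminorm_mult: "seminorm (a * y) \<le> norm a * seminorm y"
proof -
  have "(seminorm (a * y))\<^sup>2 = Re (\<tau> (star y * (star a * a) * y))"
    by (simp add: seminorm_square star_mult mult.assoc)
  also have "\<dots> \<le> norm (star a * a) * (seminorm y)\<^sup>2"
    by (rule sandwich_le) (simp add: self_adjoint_def star_mult star_star)
  also have "\<dots> = (norm a * seminorm y)\<^sup>2" by (simp add: cstar_identity power_mult_distrib)
  finally show ?thesis by (simp add: power2_le_iff_abs_le)
qed

lemma seminorm_one: "seminorm 1 = 1"
  by (simp add: seminorm_def one)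

lemma seminorm_le: "seminorm x \<le> norm x"
  using seminorm_mult[of x 1] by (simp add: seminorm_one)

lemma norm_le: "cmod (\<tau> x) \<le> norm x"
  using Cauchy_Schwarz[of 1 x] seminorm_le[of x] by (simp add: seminorm_one)

lemma bounded_linear: "bounded_linear \<tau>"
  by (rule bounded_linear_intro[of _ 1]) (auto simp: add scaleR norm_le)

lemma sum: "\<tau> (\<Sum>i\<in>I. x i) = (\<Sum>i\<in>I. \<tau> (x i))"
  by (rule linear_sum[OF bounded_linear.linear[OF bounded_linear]])

end

text \<open>
  Injectivity of the GNS representation in terms of the state; it is all that is needed to recover
  the order and the norm from the state.
\<close>

definition separating :: "('a::cstar_algebra \<Rightarrow> complex) \<Rightarrow> bool" where
  "separating \<tau> \<longleftrightarrow> (\<forall>a. (\<forall>x. \<tau> (star (a * x) * (a * x)) = 0) \<longrightarrow> a = 0)"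

lemma separating_faithful: "faithful_state \<rho> \<Longrightarrow> separating \<rho>"
  unfolding faithful_state_def separating_def by (metis mult_1_right)

lemma separating_faithful_gns:
  assumes st: "state \<tau>" and gns: "faithful_gns \<tau>"
  shows "separating \<tau>"
  unfolding separating_def
proof (intro allI impI)
  fix a assume a: "\<forall>x. \<tau> (star (a * x) * (a * x)) = 0"
  have "gns_class \<tau> (a * x) = gns_class \<tau> (0 * x)" for x
    using a by (intro gns_class_cong[OF st]) (simp add: gns_class_def)
  then have "gns_rep \<tau> a X = gns_rep \<tau> 0 X" for X
  proof (cases "X \<in> range (gns_class \<tau>)")
    case True
    then show ?thesis
      using \<open>\<And>x. gns_class \<tau> (a * x) = gns_class \<tau> (0 * x)\<close> by (auto simp: gns_rep_class[OF st])
  qed (simp add: gns_rep_def)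
  then have "gns_rep \<tau> a = gns_rep \<tau> 0" by blast
  then show "a = 0" using gns by (auto simp: faithful_gns_def inj_def)
qed

locale separating_state = cstar_state +
  assumes separating: "separating \<tau>"
begin

text \<open>The positive part \<open>y\<close> of \<open>w\<close> vanishes since it satisfies \<open>y w y = |w|\<^sup>1\<^sup>/\<^sup>2 y y |w|\<^sup>1\<^sup>/\<^sup>2\<close>.\<close>

lemma negative_square:
  assumes sa: "self_adjoint w" and neg: "\<And>z. Re (\<tau> (star z * w * z)) \<le> 0"
  obtains g where "self_adjoint g" "g * g = - w" "\<And>c. c * w = w * c \<Longrightarrow> c * g = g * c"
proof -
  obtain m k where mk: "self_adjoint m" "self_adjoint k" "m * m = w * w" "k * k = m"
    "\<And>c. c * w = w * c \<Longrightarrow> c * m = m * c" "\<And>c. c * w = w * c \<Longrightarrow> c * k = k * c"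
    using abs_exists[OF sa] by blast
  define y where "y = m + w"
  have wy: "w * y = m * y"
    using mk(3) mk(5)[of w] by (simp add: y_def algebra_simps)
  have "\<tau> (star (k * y * x) * (k * y * x)) = 0" for x
  proof -
    have "star (k * y * x) * (k * y * x) = star (y * x) * (k * k * y) * x"
      using mk(2) by (simp add: star_mult self_adjoint_def mult.assoc)
    also have "\<dots> = star (y * x) * (w * y) * x" by (simp only: mk(4) wy)
    also have "\<dots> = star (y * x) * w * (y * x)" by (simp only: mult.assoc)
    finally have "Re (\<tau> (star (k * y * x) * (k * y * x))) \<le> 0" using neg by metis
    then show ?thesis using Re_pos[of "k * y * x"] Im_pos[of "k * y * x"] by (simp add: complex_eq_iff)
  qed
  then have "k * y = 0" using separating by (simp add: separating_def)
  then have my: "m * y = 0" by (metis mk(4) mult.assoc mult_zero_right)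
  have "star y * y = m * y + w * y"
    using sa mk(1) by (simp add: y_def star_add self_adjoint_def distrib_right)
  then have "star y * y = 0" by (simp add: wy my)
  then have "y = 0" using cstar_identity[of y] by simp
  then have "k * k = - w" unfolding mk(4) by (simp add: y_def eq_neg_iff_add_eq_0)
  then show ?thesis using that mk by blast
qed

text \<open>Converse to \<open>seminorm_mult\<close>: together they identify the norm with the
  operator norm in the GNS representation. By \<open>negative_square\<close>, both
  \<open>d = star x * x\<close> and \<open>K\<^sup>2 - d\<close> are squares of self-adjoint
  elements, which commute; as the squares add up to \<open>K\<^sup>2\<close>, the lemma
  \<open>norm_commuting_squares\<close> applies.\<close>

lemma norm_le_of_seminorm:
  assumes K: "K \<ge> 0" and le: "\<And>y. seminorm (x * y) \<le> K * seminorm y"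
  shows "norm x \<le> K"
proof -
  define d where "d = star x * x"
  have sd: "star d = d" by (simp add: d_def star_mult star_star)
  have dy: "star y * d * y = star (x * y) * (x * y)" for y by (simp add: d_def star_mult mult.assoc)
  have le': "Re (\<tau> (star y * (d - (K\<^sup>2) *\<^sub>R 1) * y)) \<le> 0" for y
  proof -
    have "(seminorm (x * y))\<^sup>2 \<le> (K * seminorm y)\<^sup>2" using le by (intro power_mono) auto
    then have "Re (\<tau> (star y * d * y)) \<le> K\<^sup>2 * Re (\<tau> (star y * y))"
      by (simp add: dy seminorm_square power_mult_distrib)
    then show ?thesis by (simp add: algebra_simps diff scaleR)
  qed
  have sdK: "self_adjoint (d - (K\<^sup>2) *\<^sub>R 1)"
    by (simp add: self_adjoint_def star_diff star_scaleR sd)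
  obtain g1 where g1: "self_adjoint g1" "g1 * g1 = - (d - (K\<^sup>2) *\<^sub>R 1)"
      "\<And>c. c * (d - (K\<^sup>2) *\<^sub>R 1) = (d - (K\<^sup>2) *\<^sub>R 1) * c \<Longrightarrow> c * g1 = g1 * c"
    using negative_square[OF sdK le'] by metis
  have "Re (\<tau> (star y * (- d) * y)) \<le> 0" for y
    using Re_pos[of "x * y"] by (simp add: dy minus)
  then obtain g2 where g2: "self_adjoint g2" "g2 * g2 = - (- d)"
      "\<And>c. c * (- d) = (- d) * c \<Longrightarrow> c * g2 = g2 * c"
    using negative_square[of "- d"] sd by (metis self_adjoint_def star_minus)
  have "d * g1 = g1 * d" by (rule g1(3)) (simp add: algebra_simps)
  then have "g1 * g2 = g2 * g1" by (intro g2(3)) simp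
  then have "(norm g2)\<^sup>2 \<le> K\<^sup>2"
    by (intro norm_commuting_squares[of g2 g1]) (simp_all add: g1(1,2) g2(1,2))
  moreover have "(norm x)\<^sup>2 \<le> (norm g2)\<^sup>2"
    using g2(2) norm_mult_ineq[of g2 g2] by (simp add: d_def power2_eq_square cstar_identity)
  ultimately show ?thesis using K by (meson order_trans power2_le_imp_le)
qed

end

subsection \<open>Compressions in free products\<close>

lemma prod_list_star: "star (prod_list xs) = prod_list (rev (map star xs) :: 'a::cstar_algebra list)"
  by (induction xs) (simp_all add: star_mult)

text \<open>The factors enter as unital self-adjoint subalgebras \<open>S True\<close> and
  \<open>S False\<close>; truth values as indices let \<open>\<not> k\<close> name the opposite
  factor.\<close>

locale free_pair = separating_state \<tau> for \<tau> :: "'b::cstar_algebra \<Rightarrow> complex" +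
  fixes S :: "bool \<Rightarrow> 'b set"
  assumes S_one: "1 \<in> S k"
    and S_add: "x \<in> S k \<Longrightarrow> y \<in> S k \<Longrightarrow> x + y \<in> S k"
    and S_mult: "x \<in> S k \<Longrightarrow> y \<in> S k \<Longrightarrow> x * y \<in> S k"
    and S_scaleC: "x \<in> S k \<Longrightarrow> c *\<^sub>C x \<in> S k"
    and S_star: "x \<in> S k \<Longrightarrow> star x \<in> S k"
    and free: "free_family \<tau> S"
    and generate: "cstar_subalgebra hull (S True \<union> S False) = UNIV"
begin

section \<open>Reduced words, sorted by the factor of the first letter\<close>

definition letters :: "(bool \<times> 'b) list \<Rightarrow> bool" where
  "letters ws \<longleftrightarrow> distinct_adj (map fst ws) \<and> (\<forall>(k, b)\<in>set ws. b \<in> S k \<and> \<tau> b = 0)"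

text \<open>In the GNS space, \<open>words True\<close>, \<open>words False\<close> and
  \<open>scalars\<close> span the mutually orthogonal pieces of Voiculescu's free product Hilbert
  space.\<close>

definition words :: "bool \<Rightarrow> 'b set" where
  "words k = {prod_list (map snd ws) | ws. ws \<noteq> [] \<and> fst (hd ws) = k \<and> letters ws}"

definition scalars :: "'b set" where
  "scalars = range (\<lambda>c. c *\<^sub>C 1)"

text \<open>\<open>span\<close> is the real span; it is closed under complex scalars all the same,
  since a word absorbs a complex factor into its first letter.\<close>

definition polys :: "'b set" where
  "polys = span (words True \<union> words False \<union> scalars)"

lemma letters_zero: "letters ws \<Longrightarrow> ws \<noteq> [] \<Longrightarrow> \<tau> (prod_list (map snd ws)) = 0"
  using free unfolding free_family_def letters_def by blast

lemma letters_star: "letters ws \<Longrightarrow> letters (rev (map (\<lambda>(k, b). (k, star b)) ws))"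
  by (auto simp: letters_def rev_map[symmetric] distinct_adj_rev o_def case_prod_beta S_star hermitian)

lemma prod_list_letters_star:
  "prod_list (map snd (rev (map (\<lambda>(k, b). (k, star b)) ws))) = star (prod_list (map snd ws))"
  by (simp add: prod_list_star rev_map o_def case_prod_beta)

lemma letters_Cons:
  "letters ((k, b) # ws) \<longleftrightarrow> b \<in> S k \<and> \<tau> b = 0 \<and> (ws = [] \<or> fst (hd ws) \<noteq> k) \<and> letters ws"
  by (cases ws) (auto simp: letters_def)

lemma letters_append:
  "letters ws \<Longrightarrow> letters vs \<Longrightarrow> ws = [] \<or> vs = [] \<or> fst (last ws) \<noteq> fst (hd vs) \<Longrightarrow> letters (ws @ vs)"
  by (auto simp: letters_def distinct_adj_append_iff last_map hd_map)

lemma words_zero: "w \<in> words k \<Longrightarrow> \<tau> w = 0"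
  by (auto simp: words_def letters_zero)

text \<open>\<open>star w\<close> ends in the factor in which \<open>w\<close> begins. As
  \<open>v\<close> begins in the other factor, the concatenation is again alternating and centred,
  and freeness applies.\<close>

lemma words_orthogonal:
  assumes "w \<in> words k" "v \<in> words l" "k \<noteq> l"
  shows "\<tau> (star w * v) = 0"
proof -
  obtain ws where ws: "w = prod_list (map snd ws)" "ws \<noteq> []" "fst (hd ws) = k" "letters ws"
    using assms(1) by (auto simp: words_def)
  obtain vs where vs: "v = prod_list (map snd vs)" "vs \<noteq> []" "fst (hd vs) = l" "letters vs"
    using assms(2) by (auto simp: words_def)
  let ?ws = "rev (map (\<lambda>(k, b). (k, star b)) ws)"
  have "fst (last ?ws) = k"
    using ws(2,3) by (simp add: last_rev hd_map case_prod_beta)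
  then have "letters (?ws @ vs)"
    using letters_append[OF letters_star[OF ws(4)] vs(4)] assms(3) vs(3) by simp
  then have "\<tau> (prod_list (map snd (?ws @ vs))) = 0"
    using vs(2) by (intro letters_zero) auto
  then show ?thesis
    by (simp only: map_append prod_list.append prod_list_letters_star ws(1) vs(1))
qed

lemma span_orthogonal:
  assumes "\<And>x y. x \<in> X \<Longrightarrow> y \<in> Y \<Longrightarrow> \<tau> (star x * y) = 0" "x \<in> span X" "y \<in> span Y"
  shows "\<tau> (star x * y) = 0"
  using assms(2)
proof (rule span_induct)
  show "subspace {x. \<tau> (star x * y) = 0}"
    by (rule subspaceI) (auto simp: star_0 star_add star_scaleR distrib_right add scaleR zero)
  fix x assume x: "x \<in> X"
  show "\<tau> (star x * y) = 0"
    using assms(3)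
  proof (rule span_induct)
    show "subspace {y. \<tau> (star x * y) = 0}"
      by (rule subspaceI) (auto simp: distrib_left add scaleR zero)
  qed (use assms(1) x in auto)
qed

lemma orthogonal_words_scalars:
  assumes "x \<in> span (words k \<union> scalars)" "y \<in> span (words (\<not> k))"
  shows "\<tau> (star x * y) = 0"
  by (rule span_orthogonal[OF _ assms])
    (auto simp: words_orthogonal scalars_def star_scaleC mult_scaleC_left scaleC words_zero)

lemma orthogonal_words_scalars':
  assumes "x \<in> span (words k)" "y \<in> span (words (\<not> k) \<union> scalars)"
  shows "\<tau> (star x * y) = 0"
proof -
  have "\<tau> (star y * x) = 0" using orthogonal_words_scalars[of y "\<not> k" x] assms by simp
  then show ?thesis using hermitian[of "star y * x"] by (simp add: star_mult star_star)
qed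

lemma span_scaleC:
  assumes "\<And>x c. x \<in> X \<Longrightarrow> c *\<^sub>C x \<in> span X" "x \<in> span X"
  shows "c *\<^sub>C x \<in> span X"
  using assms(2)
proof (rule span_induct)
  show "subspace {x. c *\<^sub>C x \<in> span X}"
    by (rule subspaceI) (auto simp: span_zero span_add scaleC_add_right scaleC_commute_scaleR span_scale)
qed (use assms(1) in auto)

lemma words_scaleC: "x \<in> words k \<Longrightarrow> c *\<^sub>C x \<in> words k"
proof -
  assume "x \<in> words k"
  then obtain b ws where ws: "x = b * prod_list (map snd ws)" "letters ((k, b) # ws)"
    unfolding words_def by (auto simp: neq_Nil_conv)
  then have "letters ((k, c *\<^sub>C b) # ws)" by (simp add: letters_Cons S_scaleC scaleC)
  moreover have "c *\<^sub>C x = prod_list (map snd ((k, c *\<^sub>C b) # ws))" by (simp add: ws mult_scaleC_left)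
  ultimately show ?thesis unfolding words_def by fastforce
qed

lemma scalars_scaleC: "x \<in> scalars \<Longrightarrow> c *\<^sub>C x \<in> scalars"
  by (auto simp: scalars_def scaleC_scaleC)

lemma polys_scaleC: "x \<in> polys \<Longrightarrow> c *\<^sub>C x \<in> polys"
  unfolding polys_def by (rule span_scaleC) (auto intro: span_base simp: words_scaleC scalars_scaleC)

lemma words_polys: "w \<in> words k \<Longrightarrow> w \<in> polys"
  unfolding polys_def by (cases k) (auto intro: span_base)

lemma scalars_polys: "w \<in> scalars \<Longrightarrow> w \<in> polys"
  unfolding polys_def by (auto intro: span_base)

lemma one_scalars: "1 \<in> scalars"
  unfolding scalars_def by (rule range_eqI[of _ _ 1]) simp

lemma polys_add: "x \<in> polys \<Longrightarrow> y \<in> polys \<Longrightarrow> x + y \<in> polys"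
  unfolding polys_def by (rule span_add)

definition centre :: "'b \<Rightarrow> 'b" where
  "centre a = a - \<tau> a *\<^sub>C 1"

lemma centre: "a = \<tau> a *\<^sub>C 1 + centre a" "\<tau> (centre a) = 0"
  by (simp_all add: centre_def diff scaleC one)

lemma centre_in: "a \<in> S k \<Longrightarrow> centre a \<in> S k"
  unfolding centre_def using S_add[of a k "(- \<tau> a) *\<^sub>C 1"] S_scaleC[OF S_one, of "- \<tau> a"]
  by (simp add: scaleC_minus_left)

lemma mult_centre: "a * x = \<tau> a *\<^sub>C x + centre a * x"
  by (simp add: centre_def left_diff_distrib mult_scaleC_left)

lemma tail_words: "letters ws \<Longrightarrow> prod_list (map snd ws) \<in> words True \<union> words False \<union> scalars"
  by (cases "ws = []"; cases "fst (hd ws)") (auto simp: words_def one_scalars)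

lemma tail_polys: "letters ws \<Longrightarrow> prod_list (map snd ws) \<in> polys"
  unfolding polys_def by (rule span_base[OF tail_words])

lemma cons_words:
  "b \<in> S k \<Longrightarrow> \<tau> b = 0 \<Longrightarrow> letters ws \<Longrightarrow> ws = [] \<or> fst (hd ws) \<noteq> k \<Longrightarrow>
    b * prod_list (map snd ws) \<in> words k"
  unfolding words_def by (auto intro!: exI[of _ "(k, b) # ws"] simp: letters_Cons)

text \<open>Freeness as a statement about operators: a centred letter from factor \<open>k\<close>
  only lengthens those words that do not begin in factor \<open>k\<close>. The compression estimate
  rests on this.\<close>

lemma centred_mult:
  assumes b: "b \<in> S k" "\<tau> b = 0" and x: "x \<in> span (words (\<not> k) \<union> scalars)"
  shows "b * x \<in> span (words k)"
  using x
proof (rule span_induct)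
  show "subspace {x. b * x \<in> span (words k)}"
    by (rule subspaceI) (auto simp: span_zero distrib_left span_add span_scale)
  fix x assume "x \<in> words (\<not> k) \<union> scalars"
  then show "b * x \<in> span (words k)"
  proof
    assume "x \<in> words (\<not> k)"
    then obtain ws where "x = prod_list (map snd ws)" "letters ws" "fst (hd ws) \<noteq> k"
      by (auto simp: words_def)
    then show ?thesis using cons_words[OF b] by (auto intro: span_base)
  next
    assume "x \<in> scalars"
    then obtain c where "x = c *\<^sub>C 1" by (auto simp: scalars_def)
    moreover have "b \<in> words k" using cons_words[OF b, of "[]"] by (simp add: letters_def)
    ultimately show ?thesis by (auto simp: mult_scaleC_right intro!: span_base words_scaleC)
  qed
qed

lemma S_polys: "a \<in> S k \<Longrightarrow> a \<in> polys"
proof -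
  assume a: "a \<in> S k"
  have "centre a \<in> words k"
    using cons_words[OF centre_in[OF a] centre(2), of "[]"] by (simp add: letters_def)
  then show ?thesis
    by (subst centre(1)) (intro polys_add words_polys polys_scaleC scalars_polys one_scalars)
qed

text \<open>If the first letter of a word lies in the factor of \<open>a\<close>, the two merge, and
  \<open>mult_centre\<close> splits the merged letter into a scalar, which deletes it, and a centred
  letter. Otherwise the centred part of \<open>a\<close> is a new first letter.\<close>

lemma S_mult_polys:
  assumes a: "a \<in> S k" and x: "x \<in> polys"
  shows "a * x \<in> polys"
  using x unfolding polys_def
proof (rule span_induct)
  show "subspace {x. a * x \<in> span (words True \<union> words False \<union> scalars)}"
    by (rule subspaceI) (auto simp: span_zero distrib_left span_add span_scale)
  fix x assume x: "x \<in> words True \<union> words False \<union> scalars"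
  have "a * x \<in> polys"
  proof (cases "x \<in> scalars")
    case True
    then show ?thesis using S_polys[OF a] by (auto simp: scalars_def mult_scaleC_right polys_scaleC)
  next
    case False
    then obtain j b ws where ws: "x = b * prod_list (map snd ws)" "letters ((j, b) # ws)"
      using x unfolding words_def by (auto simp: neq_Nil_conv)
    have ws': "b \<in> S j" "\<tau> b = 0" "ws = [] \<or> fst (hd ws) \<noteq> j" "letters ws"
      using ws(2) by (simp_all add: letters_Cons)
    show ?thesis
    proof (cases "j = k")
      case True
      then have ab: "a * b \<in> S k" using a ws' by (simp add: S_mult)
      have "a * x = \<tau> (a * b) *\<^sub>C prod_list (map snd ws) + centre (a * b) * prod_list (map snd ws)"
        unfolding mult_centre[symmetric] by (simp add: ws mult.assoc)
      then show ?thesis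
        using cons_words[OF centre_in[OF ab] centre(2) ws'(4)] ws'(3) True
        by (metis polys_add polys_scaleC tail_polys ws'(4) words_polys)
    next
      case False
      have "centre a * prod_list (map snd ((j, b) # ws)) \<in> words k"
        by (rule cons_words[OF centre_in[OF a] centre(2) ws(2)]) (use False in simp)
      then have "centre a * x \<in> words k" by (simp add: ws)
      moreover have "x \<in> polys" using tail_polys[OF ws(2)] by (simp add: ws)
      ultimately show ?thesis
        by (metis mult_centre polys_add polys_scaleC words_polys)
    qed
  qed
  then show "a * x \<in> span (words True \<union> words False \<union> scalars)" by (simp add: polys_def)
qed

lemma polys_mult:
  assumes x: "x \<in> polys" and y: "y \<in> polys"
  shows "x * y \<in> polys"
  using x[unfolded polys_def]
proof (rule span_induct)
  show "subspace {x. x * y \<in> polys}"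
    unfolding polys_def by (rule subspaceI) (auto simp: span_zero distrib_right span_add span_scale)
  fix x assume x: "x \<in> words True \<union> words False \<union> scalars"
  have *: "\<forall>(k, b)\<in>set ws. b \<in> S k \<Longrightarrow> prod_list (map snd ws) * y \<in> polys" for ws
    using y by (induction ws) (auto simp: mult.assoc intro: S_mult_polys)
  show "x * y \<in> polys"
  proof (cases "x \<in> scalars")
    case True
    then show ?thesis using y by (auto simp: scalars_def mult_scaleC_left polys_scaleC)
  next
    case False
    then show ?thesis using x * by (fastforce simp: words_def letters_def)
  qed
qed

lemma polys_star:
  assumes x: "x \<in> polys"
  shows "star x \<in> polys"
  using x[unfolded polys_def]
proof (rule span_induct)
  show "subspace {x. star x \<in> polys}"
    unfolding polys_def
    by (rule subspaceI) (auto simp: star_0 star_add star_scaleR span_zero span_add span_scale)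
  fix x assume x: "x \<in> words True \<union> words False \<union> scalars"
  show "star x \<in> polys"
  proof (cases "x \<in> scalars")
    case True
    then show ?thesis by (auto simp: scalars_def star_scaleC intro!: polys_scaleC scalars_polys one_scalars)
  next
    case False
    then obtain ws where "x = prod_list (map snd ws)" "letters ws"
      using x unfolding words_def by auto
    then show ?thesis
      using tail_polys[OF letters_star[of ws]] by (simp only: prod_list_letters_star)
  qed
qed

lemma closure_polys: "closure polys = UNIV"
proof -
  have "cstar_subalgebra (closure polys)"
    unfolding cstar_subalgebra_def
  proof (intro conjI ballI allI)
    show "1 \<in> closure polys" using scalars_polys[OF one_scalars] closure_subset by blast
  next
    fix x y assume "x \<in> closure polys" "y \<in> closure polys"
    then obtain X Y where XY: "\<And>n. X n \<in> polys" "X \<longlonglongrightarrow> x" "\<And>n. Y n \<in> polys" "Y \<longlonglongrightarrow> y"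
      unfolding closure_sequential by blast
    show "x + y \<in> closure polys"
      unfolding closure_sequential
      by (intro exI[of _ "\<lambda>n. X n + Y n"] conjI allI polys_add tendsto_add XY)
    show "x * y \<in> closure polys"
      unfolding closure_sequential
      by (intro exI[of _ "\<lambda>n. X n * Y n"] conjI allI polys_mult tendsto_mult XY)
  next
    fix x c assume "x \<in> closure polys"
    then obtain X where X: "\<And>n. X n \<in> polys" "X \<longlonglongrightarrow> x"
      unfolding closure_sequential by blast
    show "star x \<in> closure polys"
      unfolding closure_sequential
      by (intro exI[of _ "\<lambda>n. star (X n)"] conjI allI polys_star X
          bounded_linear.tendsto[OF bounded_linear_star])
    have "(\<lambda>n. norm (c *\<^sub>C X n - c *\<^sub>C x)) \<longlonglongrightarrow> 0"
      using X(2) by (simp add: norm_scaleC LIM_zero tendsto_norm_zero tendsto_mult_right_zero flip: scaleC_diff_right)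
    then have "(\<lambda>n. c *\<^sub>C X n) \<longlonglongrightarrow> c *\<^sub>C x"
      by (simp add: LIM_zero_iff tendsto_norm_zero_iff)
    then show "c *\<^sub>C x \<in> closure polys"
      unfolding closure_sequential
      by (intro exI[of _ "\<lambda>n. c *\<^sub>C X n"] conjI allI polys_scaleC X)
  qed auto
  moreover have "S True \<union> S False \<subseteq> closure polys"
    using S_polys closure_subset by blast
  ultimately have "cstar_subalgebra hull (S True \<union> S False) \<subseteq> closure polys"
    by (intro hull_minimal)
  then show ?thesis by (simp add: generate top.extremum_unique)
qed

lemma polys_decompose:
  assumes "x \<in> polys"
  obtains y z where "x = y + z" "y \<in> span (words k)" "z \<in> span (words (\<not> k) \<union> scalars)"
proof -
  have "words True \<union> words False \<union> scalars = words k \<union> (words (\<not> k) \<union> scalars)"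
    by (cases k) auto
  then have "x \<in> (\<lambda>(x, y). x + y) ` (span (words k) \<times> span (words (\<not> k) \<union> scalars))"
    using assms unfolding polys_def by (simp only: span_Un[of "words k"]) auto
  then show ?thesis using that by auto
qed

lemma tendsto_seminorm: "(X \<longlongrightarrow> x) F \<Longrightarrow> ((\<lambda>n. seminorm (X n)) \<longlongrightarrow> seminorm x) F"
  unfolding seminorm_def
  by (intro tendsto_intros bounded_linear.tendsto[OF bounded_linear] bounded_linear.tendsto[OF bounded_linear_star])

text \<open>
  On a vector orthogonal to all words that begin with a letter from the algebra of \<open>p\<close>, the
  projection \<open>p\<close> acts as \<open>\<tau> p\<close> up to an orthogonal error.
\<close>

lemma projection_seminorm:
  assumes p: "p \<in> S (\<not> k)" "projection p" and x: "x \<in> span (words k \<union> scalars)"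
  shows "seminorm (p * x) = sqrt (Re (\<tau> p)) * seminorm x"
proof -
  have p': "star p = p" "p * p = p" using p(2) by (auto simp: projection_def self_adjoint_def)
  have "centre p * x \<in> span (words (\<not> k))"
    by (rule centred_mult) (use p x centre_in centre in auto)
  then have "\<tau> (star x * (centre p * x)) = 0" by (rule orthogonal_words_scalars[OF x])
  moreover have "star (p * x) * (p * x) = star x * (p * p * x)"
    by (simp only: star_mult p'(1) mult.assoc)
  then have "star (p * x) * (p * x) = star x * (\<tau> p *\<^sub>C x + centre p * x)"
    by (simp only: p'(2) mult_centre[symmetric])
  ultimately have "\<tau> (star (p * x) * (p * x)) = \<tau> p * \<tau> (star x * x)"
    by (simp add: distrib_left add mult_scaleC_right scaleC)
  then have "Re (\<tau> (star (p * x) * (p * x))) = Re (\<tau> p) * Re (\<tau> (star x * x))"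
    by (simp add: Im_pos)
  then show ?thesis by (simp add: seminorm_def real_sqrt_mult)
qed

text \<open>Since \<open>r\<close> is orthogonal to \<open>x\<close>, the square of
  \<open>seminorm x\<close> is the pairing of \<open>p * x\<close> with \<open>z\<close>;
  \<open>projection_seminorm\<close> makes \<open>p * x\<close> short, and Cauchy-Schwarz
  finishes.\<close>

lemma component_seminorm:
  assumes p: "p \<in> S (\<not> k)" "projection p" and x: "x \<in> span (words k \<union> scalars)"
    and z: "p * z = x + r" and orth: "\<tau> (star x * r) = 0"
  shows "seminorm x \<le> sqrt (Re (\<tau> p)) * seminorm z"
proof (cases "seminorm x = 0")
  case False
  have p': "star p = p" using p(2) by (auto simp: projection_def self_adjoint_def)
  have "\<tau> (star x * x) = \<tau> (star x * (p * z))"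
    by (simp add: z distrib_left add orth)
  also have "star x * (p * z) = star (p * x) * z" by (simp add: star_mult p' mult.assoc)
  finally have "(seminorm x)\<^sup>2 = cmod (\<tau> (star (p * x) * z))"
    by (metis square_eq_seminorm norm_of_real abs_of_nonneg zero_le_power2)
  also have "\<dots> \<le> seminorm (p * x) * seminorm z" by (rule Cauchy_Schwarz)
  also have "\<dots> = (sqrt (Re (\<tau> p)) * seminorm z) * seminorm x"
    by (simp add: projection_seminorm[OF p x])
  finally show ?thesis using False
    by (simp add: power2_eq_square) (metis mult_le_cancel_right not_le seminorm_nonneg order_antisym)
next
  case True
  have "Re (\<tau> p) \<ge> 0"
    using p(2) Re_pos[of p] by (simp add: projection_def self_adjoint_def)
  then show ?thesis by (simp add: True)
qed

lemma component_seminorm_le: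
  assumes "\<tau> (star x * r) = 0"
  shows "seminorm x \<le> seminorm (x + r)"
proof (cases "seminorm x = 0")
  case False
  have "\<tau> (star x * x) = \<tau> (star x * (x + r))"
    by (simp add: distrib_left add assms)
  then have "(seminorm x)\<^sup>2 = cmod (\<tau> (star x * (x + r)))"
    by (metis square_eq_seminorm norm_of_real abs_of_nonneg zero_le_power2)
  also have "\<dots> \<le> seminorm x * seminorm (x + r)" by (rule Cauchy_Schwarz)
  finally show ?thesis using False
    by (simp add: power2_eq_square) (metis mult_le_cancel_left not_le seminorm_nonneg order_antisym)
qed simp

text \<open>Pair \<open>p * y\<close> with \<open>a * (p * z)\<close> and decompose
  \<open>p * y\<close> and \<open>p * z\<close> by first letter. The parts \<open>y1\<close> and
  \<open>z1\<close> are short, of order \<open>sqrt (\<tau> p)\<close>. The only term without a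
  short part pairs \<open>y2\<close>, which begins in factor \<open>\<not> k\<close>, with
  \<open>a * z2\<close>, which begins in factor \<open>k\<close>, and vanishes; the other two terms
  give the factor \<open>2\<close>.\<close>

lemma norm_free_compression:
  assumes a: "a \<in> S k" "\<tau> a = 0" and p: "p \<in> S (\<not> k)" "projection p"
  shows "norm (p * a * p) \<le> 2 * sqrt (Re (\<tau> p)) * norm a"
proof -
  define s where "s = sqrt (Re (\<tau> p))"
  have "Re (\<tau> p) \<ge> 0"
    using p(2) Re_pos[of p] by (simp add: projection_def self_adjoint_def)
  then have s0: "s \<ge> 0" by (simp add: s_def)
  have sp: "star p = p" using p(2) by (auto simp: projection_def self_adjoint_def)
  have pz: "seminorm (p * z) \<le> seminorm z" for z
    using seminorm_mult[of p z] mult_right_mono[OF norm_projection_le[OF p(2)] seminorm_nonneg[of z]] by simp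
  have form: "cmod (\<tau> (star y * (p * a * p * z))) \<le> 2 * s * norm a * seminorm y * seminorm z"
    if y: "y \<in> polys" and z: "z \<in> polys" for y z
  proof -
    \<comment> \<open>The scalars are placed differently in the two decompositions. They may belong
      to the short part \<open>y1\<close>, so that \<open>y2\<close> consists of words only; in
      \<open>z2\<close> they do no harm, since \<open>a\<close> turns them into words beginning in
      factor \<open>k\<close>.\<close>
    obtain y2 y1 where y12: "p * y = y2 + y1" "y2 \<in> span (words (\<not> k))" "y1 \<in> span (words k \<union> scalars)"
      using polys_decompose[OF S_mult_polys[OF p(1) y], of "\<not> k"] by auto
    obtain z1 z2 where z12: "p * z = z1 + z2" "z1 \<in> span (words k)" "z2 \<in> span (words (\<not> k) \<union> scalars)"
      using polys_decompose[OF S_mult_polys[OF p(1) z], of k] by auto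
    have z1: "seminorm z1 \<le> s * seminorm z"
      unfolding s_def
      by (rule component_seminorm[OF p _ z12(1) orthogonal_words_scalars'[OF z12(2,3)]])
        (use z12(2) span_mono[of "words k" "words k \<union> scalars"] in auto)
    have y1: "seminorm y1 \<le> s * seminorm y"
      unfolding s_def
      by (rule component_seminorm[OF p y12(3), of _ y2])
        (use y12 orthogonal_words_scalars[OF y12(3,2)] in \<open>simp_all add: add.commute\<close>)
    have y2: "seminorm y2 \<le> seminorm y"
      using component_seminorm_le[of y2 y1] orthogonal_words_scalars'[of y2 "\<not> k" y1] y12 pz[of y] by simp
    have "a * z2 \<in> span (words k)" by (rule centred_mult[OF a z12(3)])
    then have 0: "\<tau> (star y2 * (a * z2)) = 0"
      using y12(2) by (intro orthogonal_words_scalars'[of _ "\<not> k"]) (auto intro: span_mono[THEN subsetD, rotated])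
    have "star y * (p * a * p * z) = star (p * y) * (a * (p * z))" by (simp add: star_mult sp mult.assoc)
    also have "\<dots> = star y1 * (a * (p * z)) + star y2 * (a * z1) + star y2 * (a * z2)"
      by (simp add: y12(1) star_add distrib_right add.commute) (simp add: z12(1) distrib_left add_ac)
    finally have "cmod (\<tau> (star y * (p * a * p * z))) =
        cmod (\<tau> (star y1 * (a * (p * z))) + \<tau> (star y2 * (a * z1)))" by (simp add: add 0)
    also have "\<dots> \<le> seminorm y1 * seminorm (a * (p * z)) + seminorm y2 * seminorm (a * z1)"
      by (intro norm_triangle_le add_mono Cauchy_Schwarz)
    also have "\<dots> \<le> (s * seminorm y) * (norm a * seminorm z) + seminorm y * (norm a * (s * seminorm z))"
      using order_trans[OF seminorm_mult[of a "p * z"] mult_left_mono[OF pz norm_ge_zero]]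
        order_trans[OF seminorm_mult[of a z1] mult_left_mono[OF z1 norm_ge_zero]] s0
      by (intro add_mono mult_mono y1 y2) auto
    finally show ?thesis by (simp add: algebra_simps)
  qed
  \<comment> \<open>Testing the form against \<open>p * a * p * z\<close> itself turns it into a
    seminorm bound.\<close>
  have bound: "seminorm (p * a * p * z) \<le> 2 * s * norm a * seminorm z" if z: "z \<in> polys" for z
  proof (cases "seminorm (p * a * p * z) = 0")
    case False
    let ?y = "p * a * p * z"
    have "?y \<in> polys"
      using z a p by (auto simp: mult.assoc intro!: S_mult_polys)
    then have "cmod (\<tau> (star ?y * ?y)) \<le> 2 * s * norm a * seminorm ?y * seminorm z"
      by (rule form[OF _ z])
    then have "seminorm ?y * seminorm ?y \<le> (2 * s * norm a * seminorm z) * seminorm ?y"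
      unfolding square_eq_seminorm norm_of_real by (simp add: power2_eq_square mult_ac)
    then show ?thesis
      using False by (metis mult_le_cancel_right not_le seminorm_nonneg order_antisym)
  qed (simp add: s0)
  have "seminorm (p * a * p * z) \<le> 2 * s * norm a * seminorm z" for z
  proof -
    have "z \<in> closure polys" by (simp add: closure_polys)
    then obtain Z where Z: "\<And>n. Z n \<in> polys" "Z \<longlonglongrightarrow> z"
      unfolding closure_sequential by blast
    have "(\<lambda>n. seminorm (p * a * p * Z n)) \<longlonglongrightarrow> seminorm (p * a * p * z)"
      by (intro tendsto_seminorm tendsto_mult_left Z)
    moreover have "(\<lambda>n. 2 * s * norm a * seminorm (Z n)) \<longlonglongrightarrow> 2 * s * norm a * seminorm z"
      by (intro tendsto_mult_left tendsto_seminorm Z)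
    ultimately show ?thesis
      by (rule LIMSEQ_le) (use bound Z(1) in auto)
  qed
  then show ?thesis
    unfolding s_def[symmetric] by (intro norm_le_of_seminorm) (use s0 in auto)
qed

text \<open>Since \<open>b\<close> is centred, the middle factor \<open>e\<close> contributes only its scalar part.\<close>

lemma free_moments:
  assumes e: "e \<in> S k" "e * e = e" and b: "b \<in> S (\<not> k)" "\<tau> b = 0"
  shows "\<tau> (e * b * e) = 0" "\<tau> (e * b * e * b * e) = \<tau> e * \<tau> e * \<tau> (b * b)"
proof -
  have ce: "centre e \<in> S k" "\<tau> (centre e) = 0" by (auto simp: centre_in e(1) centre)
  have bb: "b * b \<in> S (\<not> k)" by (rule S_mult[OF b(1) b(1)])
  have cbb: "centre (b * b) \<in> S (\<not> k)" "\<tau> (centre (b * b)) = 0" by (auto simp: centre_in bb centre)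
  define t where "t = \<tau> e"
  define d where "d = centre e"
  have e_eq: "e = t *\<^sub>C 1 + d" unfolding t_def d_def by (rule centre(1))
  define u where "u = \<tau> (b * b)"
  define q where "q = centre (b * b)"
  have bb_eq: "b * b = u *\<^sub>C 1 + q" unfolding u_def q_def by (rule centre(1))
  have z: "\<tau> (prod_list (map snd ws)) = 0" if "letters ws" "ws \<noteq> []" for ws
    using that by (rule letters_zero)
  note L = letters_Cons ce[folded d_def] cbb[folded q_def] b
  have L0: "letters []" by (simp add: letters_def)
  \<comment> \<open>The alternating products that arise from expanding \<open>e = t + d\<close> and
    \<open>b * b = u + q\<close> all have state \<open>0\<close>.\<close>
  have m1: "\<tau> d = 0" "\<tau> q = 0" using ce cbb by (auto simp: d_def q_def)
  have m2: "\<tau> (b * d) = 0" using z[of "[(\<not> k, b), (k, d)]"] by (simp add: L L0)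
  have m3: "\<tau> (d * b) = 0" using z[of "[(k, d), (\<not> k, b)]"] by (simp add: L L0)
  have m4: "\<tau> (d * (b * d)) = 0" using z[of "[(k, d), (\<not> k, b), (k, d)]"] by (simp add: L L0)
  have m5: "\<tau> (d * q) = 0" using z[of "[(k, d), (\<not> k, q)]"] by (simp add: L L0)
  have m6: "\<tau> (q * d) = 0" using z[of "[(\<not> k, q), (k, d)]"] by (simp add: L L0)
  have m7: "\<tau> (d * (q * d)) = 0" using z[of "[(k, d), (\<not> k, q), (k, d)]"] by (simp add: L L0)
  have m8: "\<tau> (b * (d * b)) = 0" using z[of "[(\<not> k, b), (k, d), (\<not> k, b)]"] by (simp add: L L0)
  have m9: "\<tau> (b * (d * (b * d))) = 0" using z[of "[(\<not> k, b), (k, d), (\<not> k, b), (k, d)]"] by (simp add: L L0)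
  have m10: "\<tau> (d * (b * (d * b))) = 0" using z[of "[(k, d), (\<not> k, b), (k, d), (\<not> k, b)]"] by (simp add: L L0)
  have m11: "\<tau> (d * (b * (d * (b * d)))) = 0"
    using z[of "[(k, d), (\<not> k, b), (k, d), (\<not> k, b), (k, d)]"] by (simp add: L L0)
  note simps = distrib_left distrib_right mult_scaleC_left mult_scaleC_right mult.assoc
    scaleC_add_right scaleC_scaleC add scaleC m1 m2 m3 m4 m5 m6 m7 m8 m9 m10 m11 b(2)
  have "\<tau> (e * b * e) = 0" by (simp add: e_eq simps)
  then show "\<tau> (e * b * e) = 0" .
  have 1: "\<tau> (e * b * d * b * e) = 0" by (simp add: e_eq simps)
  have 2: "\<tau> (e * (b * b) * e) = u * \<tau> e"
  proof -
    have "\<tau> (e * q * e) = 0" by (simp add: e_eq simps)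
    moreover have "e * (b * b) * e = u *\<^sub>C e + e * q * e"
      unfolding bb_eq
      by (simp add: distrib_left distrib_right mult_scaleC_left mult_scaleC_right e(2))
    ultimately show ?thesis by (simp add: add scaleC)
  qed
  have "e * b * e * b * e = e * b * (t *\<^sub>C 1 + d) * b * e"
    unfolding e_eq[symmetric] by (rule refl)
  also have "\<dots> = t *\<^sub>C (e * (b * b) * e) + e * b * d * b * e"
    by (simp add: distrib_left distrib_right mult_scaleC_left mult_scaleC_right mult.assoc)
  finally have "\<tau> (e * b * e * b * e) = t * (u * \<tau> e) + 0"
    by (simp only: add scaleC 1 2)
  then show "\<tau> (e * b * e * b * e) = \<tau> e * \<tau> e * \<tau> (b * b)"
    by (simp add: t_def u_def mult_ac)
qed

end

subsection \<open>Lifting from the ultrapower\<close>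

lemma ultrafilter_tendsto:
  fixes f :: "'i \<Rightarrow> 'c::heine_borel"
  assumes U: "ultrafilter U" and f: "bounded (range f)"
  obtains l where "(f \<longlongrightarrow> l) U"
proof -
  have "compact (closure (range f))" using f by simp
  moreover have "filtermap f U \<noteq> bot" using U by (simp add: ultrafilter_def filtermap_bot_iff)
  moreover have "eventually (\<lambda>x. x \<in> closure (range f)) (filtermap f U)"
    using closure_subset[of "range f"] by (auto simp: eventually_filtermap intro!: always_eventually)
  ultimately obtain l where l: "inf (nhds l) (filtermap f U) \<noteq> bot"
    unfolding compact_filter by blast
  have "(f \<longlongrightarrow> l) U"
  proof (rule topological_tendstoI, rule ccontr)
    fix V assume V: "open V" "l \<in> V" "\<not> eventually (\<lambda>x. f x \<in> V) U"
    then have "eventually (\<lambda>x. f x \<notin> V) U" using U by (auto simp: ultrafilter_def)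
    moreover have "eventually (\<lambda>x. x \<in> V) (nhds l)" using V by (auto simp: eventually_nhds)
    ultimately have "eventually (\<lambda>x. False) (inf (nhds l) (filtermap f U))"
      unfolding eventually_inf eventually_filtermap
      by (intro exI[of _ "\<lambda>x. x \<in> V"] exI[of _ "\<lambda>x. x \<notin> V"]) auto
    then show False using l by (simp add: eventually_False)
  qed
  then show ?thesis by (rule that)
qed

lemma bounded_families_iff: "x \<in> bounded_families \<longleftrightarrow> (\<exists>K. \<forall>i. norm (x i) \<le> K)"
  by (auto simp: bounded_families_def bounded_iff)

lemma bounded_families_const: "(\<lambda>_. a) \<in> bounded_families"
  by (auto simp: bounded_families_iff)

lemma bounded_families_add:
  "x \<in> bounded_families \<Longrightarrow> y \<in> bounded_families \<Longrightarrow> (\<lambda>i. x i + y i) \<in> bounded_families"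
  unfolding bounded_families_iff by (meson add_mono norm_triangle_ineq order_trans)

lemma bounded_families_mult:
  assumes "x \<in> bounded_families" "y \<in> bounded_families"
  shows "(\<lambda>i. x i * y i) \<in> bounded_families"
proof -
  obtain K L where "\<And>i. norm (x i) \<le> K" "\<And>i. norm (y i) \<le> L"
    using assms by (auto simp: bounded_families_iff)
  then have "norm (x i * y i) \<le> K * L" for i
    by (meson mult_mono norm_ge_zero norm_mult_ineq order_trans)
  then show ?thesis by (auto simp: bounded_families_iff)
qed

lemma bounded_families_scaleC: "x \<in> bounded_families \<Longrightarrow> (\<lambda>i. c *\<^sub>C x i) \<in> bounded_families"
  unfolding bounded_families_iff norm_scaleC by (meson mult_left_mono norm_ge_zero)

lemma bounded_families_star: "x \<in> bounded_families \<Longrightarrow> (\<lambda>i. star (x i)) \<in> bounded_families"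
  by (simp add: bounded_families_iff norm_star)

locale ultrapower_lifting = separating_state \<rho> for \<rho> :: "'a::cstar_algebra \<Rightarrow> complex" +
  fixes U :: "'i filter" and \<tau> :: "'b::cstar_algebra \<Rightarrow> complex" and \<sigma> :: "'b \<Rightarrow> ('i \<Rightarrow> 'a) set"
  assumes ultra: "ultrafilter U" and emb: "ultrapower_embedding U \<tau> \<rho> \<sigma>"
begin

text \<open>Tracking representatives instead of cosets turns identities in \<open>'b\<close> into
  pointwise identities in \<open>'a\<close>, up to a family that tends to \<open>0\<close> along
  \<open>U\<close>.\<close>

definition lifts :: "'b \<Rightarrow> ('i \<Rightarrow> 'a) \<Rightarrow> bool" where
  "lifts b x \<longleftrightarrow> x \<in> bounded_families \<and> \<sigma> b = up_class U x"

lemma lifts_bounded: "lifts b x \<Longrightarrow> x \<in> bounded_families"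
  by (simp add: lifts_def)

lemma lifts_exists: obtains x where "lifts b x"
proof -
  have "\<sigma> b \<in> ultrapower U" using emb by (auto simp: ultrapower_embedding_def)
  then show ?thesis using that by (auto simp: ultrapower_def lifts_def)
qed

lemma lifts_one: "lifts 1 (\<lambda>_. 1)"
  using emb by (simp add: lifts_def ultrapower_embedding_def up_diag_def bounded_families_const)

lemma lifts_add: "lifts b x \<Longrightarrow> lifts c y \<Longrightarrow> lifts (b + c) (\<lambda>i. x i + y i)"
  using emb by (simp add: lifts_def ultrapower_embedding_def bounded_families_add up_add_class)

lemma lifts_mult: "lifts b x \<Longrightarrow> lifts c y \<Longrightarrow> lifts (b * c) (\<lambda>i. x i * y i)"
  using emb by (simp add: lifts_def ultrapower_embedding_def bounded_families_mult up_mult_class)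

lemma lifts_scaleC: "lifts b x \<Longrightarrow> lifts (k *\<^sub>C b) (\<lambda>i. k *\<^sub>C x i)"
  using emb by (simp add: lifts_def ultrapower_embedding_def bounded_families_scaleC up_scaleC_class)

lemma lifts_star: "lifts b x \<Longrightarrow> lifts (star b) (\<lambda>i. star (x i))"
  using emb by (simp add: lifts_def ultrapower_embedding_def bounded_families_star up_star_class)

lemma lifts_scaleR: "lifts b x \<Longrightarrow> lifts (r *\<^sub>R b) (\<lambda>i. r *\<^sub>R x i)"
  using lifts_scaleC[of b x "of_real r"] by (simp add: scaleC_of_real)

lemma lifts_diff: "lifts b x \<Longrightarrow> lifts c y \<Longrightarrow> lifts (b - c) (\<lambda>i. x i - y i)"
  using lifts_add[of b x "(-1) *\<^sub>R c" "\<lambda>i. (-1) *\<^sub>R y i"] lifts_scaleR[of c y "-1"] by simp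

lemma lifts_zero: "lifts 0 (\<lambda>_. 0)"
  using lifts_scaleR[OF lifts_one, of 0] by simp

lemma lifts_sum: "(\<And>j. j < n \<Longrightarrow> lifts (b j) (x j)) \<Longrightarrow> lifts (\<Sum>j<n. b j) (\<lambda>i. \<Sum>j<(n::nat). x j i)"
  by (induction n) (auto simp: lifts_zero intro!: lifts_add)

lemma lifts_tendsto: "lifts b x \<Longrightarrow> lifts b y \<Longrightarrow> ((\<lambda>i. norm (x i - y i)) \<longlongrightarrow> 0) U"
  using up_class_self[of x U] by (auto simp: lifts_def up_class_def)

lemma lifts_zero_tendsto: "lifts 0 x \<Longrightarrow> ((\<lambda>i. norm (x i)) \<longlongrightarrow> 0) U"
  using lifts_tendsto[OF _ lifts_zero, of x] by simp

lemma lifts_close: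
  "lifts b x \<Longrightarrow> y \<in> bounded_families \<Longrightarrow> ((\<lambda>i. norm (x i - y i)) \<longlongrightarrow> 0) U \<Longrightarrow> lifts b y"
  using up_class_cong[of x y U] by (simp add: lifts_def)

lemma lifts_self_adjoint:
  assumes "self_adjoint b"
  obtains x where "lifts b x" "\<And>i. self_adjoint (x i)"
proof -
  obtain x where x: "lifts b x" by (rule lifts_exists)
  have "lifts ((1 / 2) *\<^sub>R (b + star b)) (\<lambda>i. (1 / 2) *\<^sub>R (x i + star (x i)))"
    by (intro lifts_scaleR lifts_add lifts_star x)
  moreover have "(1 / 2) *\<^sub>R (b + star b) = b"
    using assms scaleR_2[of b] by (simp add: self_adjoint_def flip: scaleR_2)
  moreover have "self_adjoint ((1 / 2) *\<^sub>R (x i + star (x i)))" for i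
    by (simp add: self_adjoint_def star_scaleR star_add star_star add.commute)
  ultimately show ?thesis by (intro that[of "\<lambda>i. (1 / 2) *\<^sub>R (x i + star (x i))"]) simp_all
qed

text \<open>\<open>up_state\<close> is a definite description over all representatives: the limit
  exists by compactness, and it is unique because \<open>\<rho>\<close> is contractive on the
  difference of two representatives.\<close>

lemma lifts_state:
  assumes x: "lifts b x"
  shows "((\<lambda>i. \<rho> (x i)) \<longlongrightarrow> \<tau> b) U"
proof -
  obtain K where K: "\<And>i. norm (x i) \<le> K"
    using lifts_bounded[OF x] by (auto simp: bounded_families_iff)
  then have "bounded (range (\<lambda>i. \<rho> (x i)))"
    unfolding bounded_iff using norm_le order_trans by blast
  then obtain l where l: "((\<lambda>i. \<rho> (x i)) \<longlongrightarrow> l) U"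
    using ultrafilter_tendsto[OF ultra] by blast
  have nb: "U \<noteq> bot" using ultra by (simp add: ultrafilter_def)
  have "up_state U \<rho> (\<sigma> b) = l"
    unfolding up_state_def
  proof (rule the_equality)
    show "\<exists>x\<in>\<sigma> b. ((\<lambda>i. \<rho> (x i)) \<longlongrightarrow> l) U"
      using x l up_class_self by (auto simp: lifts_def)
    fix l' assume "\<exists>y\<in>\<sigma> b. ((\<lambda>i. \<rho> (y i)) \<longlongrightarrow> l') U"
    then obtain y where y: "y \<in> up_class U x" "((\<lambda>i. \<rho> (y i)) \<longlongrightarrow> l') U"
      using x by (auto simp: lifts_def)
    have "((\<lambda>i. \<rho> (y i - x i)) \<longlongrightarrow> 0) U"
      by (rule Lim_null_comparison[of _ "\<lambda>i. norm (y i - x i)"])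
        (use y norm_le in \<open>auto simp: up_class_def intro: always_eventually\<close>)
    then have "((\<lambda>i. \<rho> (y i - x i) + \<rho> (x i)) \<longlongrightarrow> 0 + l) U" by (intro tendsto_add l)
    then have "((\<lambda>i. \<rho> (y i)) \<longlongrightarrow> l) U" by (simp add: diff)
    then show "l' = l" using y(2) nb tendsto_unique by blast
  qed
  moreover have "up_state U \<rho> (\<sigma> b) = \<tau> b" using emb by (simp add: ultrapower_embedding_def)
  ultimately show ?thesis using l by simp
qed

text \<open>The bound on \<open>norm b\<close> is first made algebraic:
  \<open>(1 / N\<^sup>2) *\<^sub>R (star b * b) + star s * s = 1\<close> for
  \<open>s = sqrt1m w\<close>. This equation lifts with an error \<open>d i\<close> tending to
  \<open>0\<close>, and \<open>\<rho>\<close> turns it back into a norm bound.\<close>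

lemma lifts_norm:
  assumes x: "lifts b x" and \<epsilon>: "\<epsilon> > 0"
  shows "eventually (\<lambda>i. norm (x i) \<le> norm b + \<epsilon>) U"
proof -
  \<comment> \<open>Half of \<open>\<epsilon>\<close> makes \<open>N\<close> positive even for
    \<open>b = 0\<close>. The tolerance \<open>\<epsilon> / (2 * N)\<close> spends the other half,
    since \<open>N * (1 + \<epsilon> / (2 * N)) = norm b + \<epsilon>\<close>.\<close>
  define N where "N = norm b + \<epsilon> / 2"
  have N: "N > 0" "norm b \<le> N" using \<epsilon> by (auto simp: N_def add_nonneg_pos)
  define w where "w = (1 / N\<^sup>2) *\<^sub>R (star b * b)"
  have w: "norm w \<le> 1" "self_adjoint w"
    using N by (auto simp: w_def cstar_identity power_mono self_adjoint_def star_scaleR star_mult star_star)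
  have sc: "star (sqrt1m w) = sqrt1m w"
    using sqrt1m_self_adjoint[OF w] by (simp add: self_adjoint_def)
  obtain z where z: "lifts (sqrt1m w) z" by (rule lifts_exists)
  define d where "d i = (1 / N\<^sup>2) *\<^sub>R (star (x i) * x i) + star (z i) * z i - 1" for i
  have "lifts ((1 / N\<^sup>2) *\<^sub>R (star b * b) + star (sqrt1m w) * sqrt1m w - 1) d"
    unfolding d_def by (intro lifts_diff lifts_add lifts_scaleR lifts_mult lifts_star x z lifts_one)
  then have "lifts 0 d" by (simp add: sc sqrt1m_square[OF w(1)]) (simp add: w_def)
  then have "((\<lambda>i. norm (d i)) \<longlongrightarrow> 0) U" by (rule lifts_zero_tendsto)
  moreover have "\<epsilon> / (2 * N) > 0" using \<epsilon> N by simp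
  ultimately have "eventually (\<lambda>i. norm (d i) < \<epsilon> / (2 * N)) U"
    by (rule order_tendstoD(2))
  then show ?thesis
  proof (rule eventually_mono)
    fix i assume di: "norm (d i) < \<epsilon> / (2 * N)"
    let ?\<eta> = "\<epsilon> / (2 * N)"
    have \<eta>: "?\<eta> > 0" by fact
    have sd: "self_adjoint (d i)"
      by (simp add: d_def self_adjoint_def star_diff star_add star_scaleR star_mult star_star)
    have "seminorm (x i * y) \<le> N * (1 + ?\<eta>) * seminorm y" for y
    proof -
      have "star (x i) * x i = N\<^sup>2 *\<^sub>R (1 + d i - star (z i) * z i)"
        using N by (simp add: d_def)
      then have "star (x i * y) * (x i * y) =
          N\<^sup>2 *\<^sub>R (star y * y + star y * d i * y - star (z i * y) * (z i * y))"
        by (simp add: star_mult mult.assoc distrib_left distrib_right left_diff_distrib right_diff_distrib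
            flip: mult.assoc[of "star (x i)"])
      then have "(seminorm (x i * y))\<^sup>2 =
          N\<^sup>2 * ((seminorm y)\<^sup>2 + Re (\<rho> (star y * d i * y)) - (seminorm (z i * y))\<^sup>2)"
        by (simp add: seminorm_square scaleR add diff)
      also have "\<dots> \<le> N\<^sup>2 * ((seminorm y)\<^sup>2 + norm (d i) * (seminorm y)\<^sup>2 - 0)"
        by (intro mult_left_mono diff_mono add_left_mono sandwich_le sd) auto
      also have "\<dots> \<le> N\<^sup>2 * ((seminorm y)\<^sup>2 + ?\<eta> * (seminorm y)\<^sup>2 - 0)"
        using di by (intro mult_left_mono diff_mono add_left_mono mult_right_mono) auto
      also have "\<dots> = N\<^sup>2 * (1 + ?\<eta>) * (seminorm y)\<^sup>2" by (simp add: algebra_simps)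
      also have "\<dots> \<le> N\<^sup>2 * (1 + ?\<eta>)\<^sup>2 * (seminorm y)\<^sup>2"
        using \<eta> by (intro mult_right_mono mult_left_mono) (auto simp: power2_eq_square)
      also have "\<dots> = (N * (1 + ?\<eta>) * seminorm y)\<^sup>2" by (simp add: power_mult_distrib)
      finally show ?thesis using N \<eta> by (simp add: power2_le_iff_abs_le)
    qed
    then have "norm (x i) \<le> N * (1 + ?\<eta>)"
      using N \<eta> by (intro norm_le_of_seminorm) auto
    also have "\<dots> = norm b + \<epsilon>" using N by (simp add: algebra_simps) (simp add: N_def)
    finally show "norm (x i) \<le> norm b + \<epsilon>" .
  qed
qed

text \<open>Arbitrary lifts are only approximately orthogonal. A lift of \<open>P n\<close> is
  therefore compressed by the complement \<open>r\<close> of the projections already chosen, so that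
  it annihilates them exactly, and \<open>near_projection\<close> corrects it without losing
  this.\<close>

lemma lifts_projections:
  fixes P :: "nat \<Rightarrow> 'b"
  assumes "\<And>i. i < n \<Longrightarrow> projection (P i)"
    and "\<And>i j. i < n \<Longrightarrow> j < n \<Longrightarrow> i \<noteq> j \<Longrightarrow> P i * P j = 0"
  shows "\<exists>q. (\<forall>i<n. lifts (P i) (q i)) \<and>
    eventually (\<lambda>t. (\<forall>i<n. projection (q i t)) \<and> (\<forall>i<n. \<forall>j<n. i \<noteq> j \<longrightarrow> q i t * q j t = 0)) U"
  using assms
proof (induction n)
  case (Suc n)
  have "\<exists>q. (\<forall>i<n. lifts (P i) (q i)) \<and>
    eventually (\<lambda>t. (\<forall>i<n. projection (q i t)) \<and> (\<forall>i<n. \<forall>j<n. i \<noteq> j \<longrightarrow> q i t * q j t = 0)) U"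
    by (rule Suc.IH) (use Suc.prems in auto)
  then obtain q where q: "\<And>i. i < n \<Longrightarrow> lifts (P i) (q i)"
    and ev: "eventually (\<lambda>t. (\<forall>i<n. projection (q i t)) \<and> (\<forall>i<n. \<forall>j<n. i \<noteq> j \<longrightarrow> q i t * q j t = 0)) U"
    by blast
  have Pn: "projection (P n)" using Suc.prems by simp
  then obtain x where x: "lifts (P n) x" "\<And>i. self_adjoint (x i)"
    using lifts_self_adjoint unfolding projection_def by metis
  define r where "r t = 1 - (\<Sum>i<n. q i t)" for t
  define w where "w t = star (r t) * x t * r t" for t
  define R where "R = 1 - (\<Sum>i<n. P i)"
  have r: "lifts R r"
    unfolding r_def R_def by (intro lifts_diff lifts_one lifts_sum q)
  have RP: "R * P n = P n"
    using Suc.prems(2) by (simp add: R_def left_diff_distrib sum_distrib_right)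
  have PR: "P n * R = P n"
    using Suc.prems(2) by (simp add: R_def right_diff_distrib sum_distrib_left)
  have "star R = R"
    using Suc.prems(1) by (simp add: R_def star_diff star_sum projection_def self_adjoint_def)
  then have w: "lifts (P n) w"
    using lifts_mult[OF lifts_mult[OF lifts_star[OF r] x(1)] r] by (simp add: w_def[abs_def] RP PR)
  have sw: "self_adjoint (w t)" for t
    using x(2)[of t] by (simp add: w_def self_adjoint_def star_mult star_star mult.assoc)
  have "lifts (P n * P n - P n) (\<lambda>t. w t * w t - w t)" by (intro lifts_diff lifts_mult w)
  then have lim: "((\<lambda>t. norm (w t * w t - w t)) \<longlongrightarrow> 0) U"
    using Pn by (intro lifts_zero_tendsto) (simp add: projection_def)
  define good where "good t \<longleftrightarrow> norm (w t * w t - w t) \<le> 1 / 8" for t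
  have ev_good: "eventually good U"
    unfolding good_def by (rule eventually_mono[OF order_tendstoD(2)[OF lim, of "1 / 8"]]) auto
  \<comment> \<open>At the other indices \<open>0\<close> is a witness, so that \<open>p\<close>
    consists of projections throughout and is a bounded family.\<close>
  have "\<exists>p. projection p \<and> (good t \<longrightarrow>
      norm (p - w t) \<le> 2 * norm (w t * w t - w t) \<and> (\<forall>c. w t * c = 0 \<longrightarrow> p * c = 0))" for t
  proof (cases "good t")
    case True
    then show ?thesis using near_projection[OF sw[of t]] unfolding good_def by metis
  qed (use projection_zero in auto)
  then obtain p where p: "\<And>t. projection (p t)"
    "\<And>t. good t \<Longrightarrow> norm (p t - w t) \<le> 2 * norm (w t * w t - w t)"
    "\<And>t c. good t \<Longrightarrow> w t * c = 0 \<Longrightarrow> p t * c = 0"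
    by metis
  have "((\<lambda>t. norm (w t - p t)) \<longlongrightarrow> 0) U"
  proof (rule Lim_null_comparison[of _ "\<lambda>t. 2 * norm (w t * w t - w t)"])
    show "eventually (\<lambda>t. norm (norm (w t - p t)) \<le> 2 * norm (w t * w t - w t)) U"
      using ev_good by (rule eventually_mono) (use p(2) in \<open>simp add: norm_minus_commute\<close>)
    show "((\<lambda>t. 2 * norm (w t * w t - w t)) \<longlongrightarrow> 0) U"
      by (rule tendsto_mult_right_zero[OF lim])
  qed
  moreover have "p \<in> bounded_families"
    unfolding bounded_families_iff using norm_projection_le[OF p(1)] by blast
  ultimately have lp: "lifts (P n) p" by (rule lifts_close[OF w, rotated])
  have "eventually (\<lambda>t. (\<forall>i<Suc n. projection ((q(n := p)) i t)) \<and>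
      (\<forall>i<Suc n. \<forall>j<Suc n. i \<noteq> j \<longrightarrow> (q(n := p)) i t * (q(n := p)) j t = 0)) U"
    using ev ev_good
  proof eventually_elim
    case (elim t)
    have pq: "p t * q i t = 0" if i: "i < n" for i
    proof -
      have "(\<Sum>j<n. q j t) * q i t = (\<Sum>j<n. if j = i then q i t else 0)"
        unfolding sum_distrib_right
        by (intro sum.cong) (use elim i in \<open>auto simp: projection_def\<close>)
      then have "r t * q i t = 0" using i by (simp add: r_def left_diff_distrib)
      then show ?thesis
        by (intro p(3)) (use elim in \<open>simp_all add: w_def mult.assoc\<close>)
    qed
    have qp: "q i t * p t = 0" if i: "i < n" for i
    proof -
      have "star (p t * q i t) = 0" by (simp add: pq i star_0)
      then show ?thesis using elim i p(1)[of t] by (simp add: star_mult projection_def self_adjoint_def)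
    qed
    show ?case using elim p(1) pq qp by (auto simp: less_Suc_eq)
  qed
  moreover have "\<forall>i<Suc n. lifts (P i) ((q(n := p)) i)" using q lp by (auto simp: less_Suc_eq)
  ultimately show ?case by blast
qed auto

text \<open>Eventually the defect \<open>1 - (\<Sum>i<n. q i t)\<close> is itself a projection. Its
  norm tends to \<open>0\<close>, and a projection of norm below \<open>1\<close> is
  \<open>0\<close>, so the sum is exactly \<open>1\<close>.\<close>

lemma lifts_projection_partition:
  fixes P :: "nat \<Rightarrow> 'b"
  assumes "\<And>i. i < n \<Longrightarrow> projection (P i)"
    and "\<And>i j. i < n \<Longrightarrow> j < n \<Longrightarrow> i \<noteq> j \<Longrightarrow> P i * P j = 0"
    and sum: "(\<Sum>i<n. P i) = 1"
  obtains q where "\<And>i. i < n \<Longrightarrow> lifts (P i) (q i)"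
    "eventually (\<lambda>t. (\<forall>i<n. projection (q i t)) \<and> (\<forall>i<n. \<forall>j<n. i \<noteq> j \<longrightarrow> q i t * q j t = 0) \<and>
      (\<Sum>i<n. q i t) = 1) U"
proof -
  obtain q where q: "\<And>i. i < n \<Longrightarrow> lifts (P i) (q i)"
    and ev: "eventually (\<lambda>t. (\<forall>i<n. projection (q i t)) \<and> (\<forall>i<n. \<forall>j<n. i \<noteq> j \<longrightarrow> q i t * q j t = 0)) U"
    using lifts_projections[of n P] assms by blast
  have "lifts (1 - (\<Sum>i<n. P i)) (\<lambda>t. 1 - (\<Sum>i<n. q i t))"
    by (intro lifts_diff lifts_one lifts_sum q)
  then have "((\<lambda>t. norm (1 - (\<Sum>i<n. q i t))) \<longlongrightarrow> 0) U"
    by (intro lifts_zero_tendsto) (simp add: sum)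
  then have "eventually (\<lambda>t. norm (1 - (\<Sum>i<n. q i t)) < 1) U"
    by (rule order_tendstoD) simp
  with ev have "eventually (\<lambda>t. (\<forall>i<n. projection (q i t)) \<and>
      (\<forall>i<n. \<forall>j<n. i \<noteq> j \<longrightarrow> q i t * q j t = 0) \<and> (\<Sum>i<n. q i t) = 1) U"
  proof eventually_elim
    case (elim t)
    let ?Q = "\<Sum>i<n. q i t"
    have "q i t * ?Q = q i t" if i: "i < n" for i
    proof -
      have "q i t * ?Q = (\<Sum>j<n. if j = i then q i t else 0)"
        unfolding sum_distrib_left
        by (intro sum.cong) (use elim i in \<open>auto simp: projection_def\<close>)
      then show ?thesis using i by simp
    qed
    then have "?Q * ?Q = ?Q" by (simp add: sum_distrib_right)
    moreover have "star ?Q = ?Q" using elim by (simp add: star_sum projection_def self_adjoint_def)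
    ultimately have "projection (1 - ?Q)"
      by (intro projection_compl) (simp add: projection_def self_adjoint_def)
    then have "norm (1 - ?Q) = 0" using norm_projection_cases elim by fastforce
    then show ?case using elim by simp
  qed
  then show ?thesis using that q by blast
qed

end

subsection \<open>Small projections\<close>

context separating_state
begin

lemma projection_state:
  assumes "projection p"
  shows "(seminorm p)\<^sup>2 = Re (\<tau> p)" "Re (\<tau> p) \<ge> 0"
proof -
  show "(seminorm p)\<^sup>2 = Re (\<tau> p)"
    using assms by (simp add: seminorm_square projection_def self_adjoint_def)
  then show "Re (\<tau> p) \<ge> 0" by (metis zero_le_power2)
qed

text \<open>
  If the two spectral projections of \<open>h = e x e\<close> cannot both have substantial mass, then \<open>|h|\<close> and
  \<open>h\<close> have nearly the same mass up to sign, while \<open>h\<close> has mass near \<open>0\<close> and \<open>h\<^sup>2 \<le> \<parallel>h\<parallel> |h|\<close> does not.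
\<close>

lemma split_projection:
  assumes RR0: "real_rank_zero TYPE('a)"
    and \<alpha>: "\<alpha> > 0" and \<beta>: "\<beta> > 0" and R: "R \<ge> 0"
    and test: "\<And>e \<eta>. projection e \<Longrightarrow> \<eta> > 0 \<Longrightarrow> \<exists>x. self_adjoint x \<and> norm x \<le> R \<and>
      \<bar>Re (\<tau> (e * x * e))\<bar> < \<eta> \<and> Re (\<tau> (e * x * e * x * e)) > (Re (\<tau> e))\<^sup>2 * \<beta> - \<eta>"
  shows "\<exists>\<delta>>0. \<forall>e. projection e \<longrightarrow> Re (\<tau> e) \<ge> \<alpha> \<longrightarrow>
    (\<exists>f. projection f \<and> e * f = f \<and> \<delta> < Re (\<tau> f) \<and> Re (\<tau> f) < Re (\<tau> e) - \<delta>)"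
proof -
  define M where "M = R + 1"
  have M: "M \<ge> 1" using R by (simp add: M_def)
  \<comment> \<open>With this choice \<open>2 * (M\<^sup>2 * sqrt \<delta>)\<close> and
    \<open>4 * (M * \<eta>)\<close> are each at most half of
    \<open>\<alpha>\<^sup>2 * \<beta>\<close>, which the closing contradiction requires. Neither
    constant depends on \<open>e\<close>.\<close>
  define \<delta> where "\<delta> = (\<alpha>\<^sup>2 * \<beta> / (4 * M\<^sup>2))\<^sup>2"
  define \<eta> where "\<eta> = min 1 (\<alpha>\<^sup>2 * \<beta> / (8 * M))"
  have c: "\<alpha>\<^sup>2 * \<beta> > 0" using \<alpha> \<beta> by simp
  have s\<delta>: "sqrt \<delta> = \<alpha>\<^sup>2 * \<beta> / (4 * M\<^sup>2)" using c M by (simp add: \<delta>_def)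
  have \<delta>: "\<delta> > 0" using \<alpha> \<beta> M by (simp add: \<delta>_def)
  have \<eta>: "\<eta> > 0" "\<eta> \<le> 1" "\<eta> \<le> \<alpha>\<^sup>2 * \<beta> / (8 * M)" using c M by (auto simp: \<eta>_def)
  have "\<exists>f. projection f \<and> e * f = f \<and> \<delta> < Re (\<tau> f) \<and> Re (\<tau> f) < Re (\<tau> e) - \<delta>"
    if e: "projection e" and \<alpha>e: "Re (\<tau> e) \<ge> \<alpha>" for e
  proof -
    have e': "e * e = e" "star e = e" using e by (auto simp: projection_def self_adjoint_def)
    have ee: "e * (e * z) = e * z" for z by (simp add: e' flip: mult.assoc)
    obtain x where x: "self_adjoint x" "norm x \<le> R" "\<bar>Re (\<tau> (e * x * e))\<bar> < \<eta>"
      "Re (\<tau> (e * x * e * x * e)) > (Re (\<tau> e))\<^sup>2 * \<beta> - \<eta>"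
      using test[OF e \<eta>(1)] by blast
    define h where "h = e * x * e"
    have sx: "star x = x" using x(1) by (simp add: self_adjoint_def)
    have h: "e * h = h" "h * e = h" "star h = h" by (auto simp: h_def mult.assoc e' ee star_mult sx)
    have nh: "norm h \<le> R" using norm_compress[OF e e, of x] x(2) by (simp add: h_def)
    have hh: "h * h = e * x * e * x * e" by (simp add: h_def mult.assoc ee)
    \<comment> \<open>The unit of the complementary corner is added so that, after
      \<open>commuting_invertible\<close>, the invertible approximant still approximates
      \<open>h\<close> in the corner of \<open>e\<close>.\<close>
    have "self_adjoint (h + (1 - e))" by (simp add: self_adjoint_def star_add star_diff h e')
    then have "h + (1 - e) \<in> closure {x. self_adjoint x \<and> invertible_element x}"
      using RR0 by (auto simp: real_rank_zero_def)
    then obtain y where y: "self_adjoint y" "invertible_element y" "dist y (h + (1 - e)) < \<eta> / 2"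
      unfolding closure_approachable using \<eta>(1) by (metis (mono_tags, lifting) half_gt_zero mem_Collect_eq)
    obtain Y where Y: "self_adjoint Y" "invertible_element Y" "e * Y = Y * e" "norm (e * Y - h) \<le> 2 * (\<eta> / 2)"
      by (rule commuting_invertible[OF e h(1,2) y(1,2), of "\<eta> / 2"])
        (use y(3) \<eta> in \<open>auto simp: dist_norm\<close>)
    obtain S k where S: "self_adjoint S" "self_adjoint k" "S * S = 1" "Y * S = k * k"
      "\<And>c. c * Y = Y * c \<Longrightarrow> c * S = S * c" "\<And>c. c * Y = Y * c \<Longrightarrow> c * k = k * c"
      using sign_exists[OF Y(1,2)] by blast
    have Se: "e * S = S * e" using S(5)[OF Y(3)] .
    have ke: "e * k = k * e" using S(6)[OF Y(3)] .
    have YS: "Y * S = S * Y" using S(5)[of Y] by simp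
    have st: "star S = S" "star k = k" using S(1,2) by (auto simp: self_adjoint_def)
    have kez: "k * (e * z) = e * (k * z)" and Yez: "Y * (e * z) = e * (Y * z)"
      and Sez: "S * (e * z) = e * (S * z)" and SYz: "S * (Y * z) = Y * (S * z)"
      and SSz: "S * (S * z) = z" for z
      using ke Y(3) Se YS S(3) by (metis mult.assoc mult_1)+
    note order = mult.assoc ke[symmetric] kez Y(3)[symmetric] Yez Se[symmetric] Sez YS[symmetric] SYz S(3) SSz e' ee
    \<comment> \<open>\<open>T\<close> approximates \<open>h\<close> inside the corner of
      \<open>e\<close>. Below, \<open>T * S\<close> is \<open>|T|\<close>, and \<open>f\<close> and
      \<open>f'\<close> are the spectral projections of \<open>T\<close> for the positive and the
      negative half line.\<close>
    define T where "T = e * Y"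
    have nTh: "norm (T - h) \<le> \<eta>" using Y(4) by (simp add: T_def)
    have nT: "norm T \<le> M"
      using norm_triangle_ineq[of "T - h" h] nTh nh \<eta>(2) by (simp add: M_def)
    have T1: "\<bar>Re (\<tau> T)\<bar> < 2 * \<eta>"
    proof -
      have "\<bar>Re (\<tau> (T - h))\<bar> \<le> \<eta>"
        using abs_Re_le_cmod[of "\<tau> (T - h)"] norm_le[of "T - h"] nTh by simp
      then show ?thesis using x(3) by (simp add: diff h_def)
    qed
    have T2: "Re (\<tau> (T * T)) > \<alpha>\<^sup>2 * \<beta> - 2 * \<eta> * M"
    proof -
      have "T * T - h * h = (T - h) * T + h * (T - h)" by (simp add: algebra_simps)
      then have "norm (T * T - h * h) \<le> norm (T - h) * norm T + norm h * norm (T - h)"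
        by (metis add_mono norm_mult_ineq norm_triangle_le)
      also have "\<dots> \<le> \<eta> * M + R * \<eta>"
        using nTh nT nh \<eta>(1) R by (intro add_mono mult_mono) auto
      finally have "\<bar>Re (\<tau> (T * T - h * h))\<bar> \<le> \<eta> * M + R * \<eta>"
        using abs_Re_le_cmod[of "\<tau> (T * T - h * h)"] norm_le[of "T * T - h * h"] by simp
      moreover have "\<alpha>\<^sup>2 * \<beta> \<le> (Re (\<tau> e))\<^sup>2 * \<beta>"
        using \<alpha>e \<alpha> \<beta> by (intro mult_right_mono power_mono) auto
      ultimately show ?thesis using x(4) by (simp add: diff hh M_def algebra_simps)
    qed
    define f where "f = (1 / 2) *\<^sub>R (e + e * S)"
    define f' where "f' = (1 / 2) *\<^sub>R (e - e * S)"
    have eSeS: "e * S * (e * S) = e" by (metis S(3) Se e'(1) mult.assoc mult_1_right)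
    have eeS: "e * (e * S) = e * S" "e * S * e = e * S" by (simp_all add: ee) (metis Se e'(1) mult.assoc)
    have seS: "star (e * S) = e * S" by (simp add: star_mult st e' Se)
    have f: "projection f"
    proof -
      have "(e + e * S) * (e + e * S) = 2 *\<^sub>R (e + e * S)"
        by (simp only: distrib_left distrib_right eSeS eeS e' scaleR_2 add_ac)
      then have "f * f = f" by (simp add: f_def)
      then show ?thesis by (simp add: projection_def self_adjoint_def f_def star_scaleR star_add e' seS)
    qed
    have "f + f' = e"
      unfolding f_def f'_def scaleR_right_distrib[symmetric] by (simp flip: scaleR_2)
    then have f': "f' = e - f" by (metis add_diff_cancel_left')
    have ef: "e * f = f" by (simp add: f_def distrib_left e' ee)
    have pf': "projection f'" unfolding f' by (rule projection_diff[OF e f ef])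
    have TS: "T * S = e * k * k" by (simp add: T_def mult.assoc S(4))
    have Te: "T * e = T" by (simp add: T_def mult.assoc e' flip: Y(3)) (simp add: ee)
    \<comment> \<open>If \<open>f'\<close> has small state, then \<open>|T|\<close> is close to
      \<open>T\<close> in state; if \<open>f\<close> has, then to \<open>-T\<close>. As
      \<open>T\<close> has small state, so does \<open>|T|\<close> in either case.\<close>
    have TS1: "T * S = T - 2 *\<^sub>R (T * f')" "T * S = 2 *\<^sub>R (T * f) - T"
      by (simp_all add: f_def f'_def distrib_left right_diff_distrib Te mult.assoc[symmetric])
    have nTS: "norm (T * S) \<le> M"
      using norm_mult_ineq[of T S] nT norm_symmetry[OF S(1,3)] by simp
    \<comment> \<open>That is, \<open>|T|\<^sup>1\<^sup>/\<^sup>2 |T| |T|\<^sup>1\<^sup>/\<^sup>2 =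
      T\<^sup>2\<close>, from which \<open>sandwich_le\<close> bounds the state of
      \<open>T\<^sup>2\<close> by \<open>M\<close> times that of \<open>|T|\<close>.\<close>
    have "star (k * e) * (T * S) * (k * e) = T * S * (T * S)"
      unfolding TS star_mult st e' by (simp add: order)
    also have "\<dots> = T * T" by (simp add: T_def order)
    finally have TT: "star (k * e) * (T * S) * (k * e) = T * T" .
    have "star (T * S) = T * S"
      unfolding TS star_mult st e' by (simp add: order)
    then have "Re (\<tau> (T * T)) \<le> norm (T * S) * (seminorm (k * e))\<^sup>2"
      unfolding TT[symmetric] by (intro sandwich_le) (simp add: self_adjoint_def)
    also have "\<dots> \<le> M * (seminorm (k * e))\<^sup>2"
      by (rule mult_right_mono[OF nTS]) simp
    also have "(seminorm (k * e))\<^sup>2 = Re (\<tau> (T * S))"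
      unfolding seminorm_square TS star_mult st e' by (simp add: order)
    finally have TTS: "Re (\<tau> (T * T)) \<le> M * Re (\<tau> (T * S))" .
    have Tg: "\<bar>Re (\<tau> (T * g))\<bar> \<le> M * sqrt \<delta>" if g: "projection g" "Re (\<tau> g) \<le> \<delta>" for g
    proof -
      have "\<bar>Re (\<tau> (T * g))\<bar> \<le> cmod (\<tau> (star (star T) * g))"
        by (simp add: abs_Re_le_cmod star_star)
      also have "\<dots> \<le> seminorm (star T) * seminorm g" by (rule Cauchy_Schwarz)
      also have "\<dots> \<le> M * sqrt \<delta>"
        using seminorm_le[of "star T"] nT M g projection_state(1)[OF g(1)] \<delta>
        by (intro mult_mono) (auto simp: norm_star intro: real_le_rsqrt)
      finally show ?thesis .
    qed
    have "\<delta> < Re (\<tau> f) \<and> \<delta> < Re (\<tau> f')"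
    proof (rule ccontr)
      assume "\<not> ?thesis"
      then consider "Re (\<tau> f) \<le> \<delta>" | "Re (\<tau> f') \<le> \<delta>" by linarith
      then have "Re (\<tau> (T * S)) \<le> 2 * \<eta> + 2 * (M * sqrt \<delta>)"
      proof cases
        case 1
        then show ?thesis using Tg[OF f] T1 unfolding TS1(2) by (simp add: diff scaleR)
      next
        case 2
        then show ?thesis using Tg[OF pf'] T1 unfolding TS1(1) by (simp add: diff scaleR)
      qed
      then have "M * Re (\<tau> (T * S)) \<le> M * (2 * \<eta> + 2 * (M * sqrt \<delta>))"
        using M by (intro mult_left_mono) auto
      then have "\<alpha>\<^sup>2 * \<beta> < 4 * (M * \<eta>) + 2 * (M\<^sup>2 * sqrt \<delta>)"
        using T2 TTS by (simp add: algebra_simps power2_eq_square)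
      moreover have "M\<^sup>2 * sqrt \<delta> = \<alpha>\<^sup>2 * \<beta> / 4" using M by (simp add: s\<delta>)
      moreover have "M * \<eta> \<le> \<alpha>\<^sup>2 * \<beta> / 8" using \<eta>(3) M by (simp add: field_simps)
      ultimately show False by linarith
    qed
    then show ?thesis using f ef by (intro exI[of _ f]) (simp add: f' diff)
  qed
  then show ?thesis using \<delta> by blast
qed

section \<open>Partitions into orthogonal projections of small state\<close>

definition orthogonal_projections :: "'a list \<Rightarrow> bool" where
  "orthogonal_projections L \<longleftrightarrow> (\<forall>p\<in>set L. projection p) \<and> sorted_wrt (\<lambda>p q. p * q = 0) L"

lemma projection_orthogonal_sym: "projection p \<Longrightarrow> projection q \<Longrightarrow> p * q = 0 \<Longrightarrow> q * p = 0"
  unfolding projection_def self_adjoint_def by (metis star_0 star_mult)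

lemma orthogonal_projections_mult_sum:
  "orthogonal_projections L \<Longrightarrow> p \<in> set L \<Longrightarrow> p * sum_list L = p"
proof (induction L arbitrary: p)
  case (Cons a L)
  have *: "q * sum_list K = 0" if "\<forall>r\<in>set K. q * r = 0" for q :: 'a and K
    using that by (induction K) (auto simp: distrib_left)
  have L: "orthogonal_projections L" "projection a" "\<forall>q\<in>set L. projection q \<and> a * q = 0"
    using Cons.prems by (auto simp: orthogonal_projections_def)
  show ?case
  proof (cases "p = a")
    case True
    then show ?thesis using L *[of L a] by (simp add: distrib_left projection_def)
  next
    case False
    then have p: "p \<in> set L" using Cons.prems by simp
    then have "p * a = 0" using L projection_orthogonal_sym by blast
    then show ?thesis using Cons.IH[OF L(1) p] by (simp add: distrib_left)
  qed
qed simp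

lemma orthogonal_projections_append:
  assumes "orthogonal_projections L" "orthogonal_projections K" "sum_list L * sum_list K = 0"
    and "projection (sum_list K)"
  shows "orthogonal_projections (L @ K)"
proof -
  have "p * q = 0" if p: "p \<in> set L" and q: "q \<in> set K" for p q
  proof -
    have pq: "p = p * sum_list L" "q = q * sum_list K"
      using orthogonal_projections_mult_sum assms(1,2) p q by metis+
    have "star q = q" "star (sum_list K) = sum_list K"
      using assms(2,4) q by (auto simp: orthogonal_projections_def projection_def self_adjoint_def)
    then have "q = sum_list K * q" using pq(2) by (metis star_mult)
    then have "p * q = p * (sum_list L * sum_list K) * q" using pq(1) by (metis mult.assoc)
    then show ?thesis by (simp add: assms(3))
  qed
  then show ?thesis using assms by (auto simp: orthogonal_projections_def sorted_wrt_append)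
qed

text \<open>Both \<open>f\<close> and \<open>e - f\<close> have state below
  \<open>Re (\<tau> e) - \<delta>\<close>, so each gets by with a budget smaller by one. The
  recursion ends because \<open>\<delta>\<close> is the same for all \<open>e\<close>.\<close>

lemma partition_projection:
  assumes split: "\<And>e. projection e \<Longrightarrow> Re (\<tau> e) \<ge> \<epsilon> \<Longrightarrow>
      \<exists>f. projection f \<and> e * f = f \<and> \<delta> < Re (\<tau> f) \<and> Re (\<tau> f) < Re (\<tau> e) - \<delta>"
    and "projection e" "Re (\<tau> e) < \<epsilon> + real n * \<delta>"
  shows "\<exists>L. orthogonal_projections L \<and> (\<forall>p\<in>set L. Re (\<tau> p) < \<epsilon>) \<and> sum_list L = e"
  using assms(2,3)
proof (induction n arbitrary: e)
  case 0
  then show ?case by (intro exI[of _ "[e]"]) (auto simp: orthogonal_projections_def)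
next
  case (Suc n)
  show ?case
  proof (cases "Re (\<tau> e) < \<epsilon>")
    case True
    then show ?thesis
      using Suc.prems by (intro exI[of _ "[e]"]) (auto simp: orthogonal_projections_def)
  next
    case False
    then obtain f where f: "projection f" "e * f = f" "\<delta> < Re (\<tau> f)" "Re (\<tau> f) < Re (\<tau> e) - \<delta>"
      using split[OF Suc.prems(1)] by auto
    have f': "projection (e - f)" by (rule projection_diff[OF Suc.prems(1) f(1,2)])
    have "f * e = f" using f(1,2) Suc.prems(1) unfolding projection_def self_adjoint_def by (metis star_mult)
    then have ff': "f * (e - f) = 0" using f(1) by (simp add: right_diff_distrib projection_def)
    obtain L where L: "orthogonal_projections L" "\<forall>p\<in>set L. Re (\<tau> p) < \<epsilon>" "sum_list L = f"
      using Suc.IH[OF f(1)] f(4) Suc.prems(2) by (auto simp: algebra_simps)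
    obtain K where K: "orthogonal_projections K" "\<forall>p\<in>set K. Re (\<tau> p) < \<epsilon>" "sum_list K = e - f"
      using Suc.IH[OF f'] f(3) Suc.prems(2) by (auto simp: algebra_simps diff)
    have "orthogonal_projections (L @ K)"
      by (rule orthogonal_projections_append[OF L(1) K(1)]) (use L(3) K(3) ff' f' in auto)
    then show ?thesis using L K by (intro exI[of _ "L @ K"]) auto
  qed
qed

subsection \<open>Normal plus nilpotent\<close>

lemma seminorm_sum_orthogonal:
  assumes "\<And>i j. i < n \<Longrightarrow> j < n \<Longrightarrow> i \<noteq> j \<Longrightarrow> star (v i) * v j = 0"
  shows "(seminorm (\<Sum>i<n. v i))\<^sup>2 = (\<Sum>i<(n::nat). (seminorm (v i))\<^sup>2)"
proof -
  have "star (\<Sum>i<n. v i) * (\<Sum>i<n. v i) = (\<Sum>i<n. \<Sum>j<n. star (v i) * v j)"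
    by (simp add: star_sum sum_product)
  also have "\<dots> = (\<Sum>i<n. \<Sum>j<n. if j = i then star (v i) * v i else 0)"
    by (intro sum.cong refl) (use assms in auto)
  also have "\<dots> = (\<Sum>i<n. star (v i) * v i)" by simp
  finally show ?thesis by (simp add: seminorm_square sum)
qed

text \<open>The vectors \<open>q i * y\<close> are pairwise orthogonal with sum \<open>y\<close>,
  and so are their images under the blocks; Pythagoras on both sides yields the maximum of the block
  norms rather than their sum.\<close>

lemma norm_block_diagonal:
  fixes q :: "nat \<Rightarrow> 'a"
  assumes proj: "\<And>i. i < n \<Longrightarrow> projection (q i)"
    and orth: "\<And>i j. i < n \<Longrightarrow> j < n \<Longrightarrow> i \<noteq> j \<Longrightarrow> q i * q j = 0"
    and sum: "(\<Sum>i<n. q i) = 1"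
    and le: "\<And>i. i < n \<Longrightarrow> norm (q i * x * q i) \<le> \<epsilon>" and \<epsilon>: "\<epsilon> \<ge> 0"
  shows "norm (\<Sum>i<n. q i * x * q i) \<le> \<epsilon>"
proof (rule norm_le_of_seminorm[OF \<epsilon>])
  fix y
  have q: "star (q i) = q i" "q i * q i = q i" if "i < n" for i
    using proj[OF that] by (auto simp: projection_def self_adjoint_def)
  have orth': "q i * (q j * z) = 0" if "i < n" "j < n" "i \<noteq> j" for i j z
    using orth[OF that] by (simp flip: mult.assoc)
  have "(seminorm (\<Sum>i<n. q i * x * q i * y))\<^sup>2 = (\<Sum>i<n. (seminorm (q i * x * q i * y))\<^sup>2)"
    by (intro seminorm_sum_orthogonal) (simp add: star_mult q mult.assoc orth')
  also have "\<dots> \<le> (\<Sum>i<n. \<epsilon>\<^sup>2 * (seminorm (q i * y))\<^sup>2)"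
  proof (intro sum_mono)
    fix i assume "i \<in> {..<n}"
    then have i: "i < n" by simp
    have "q i * x * q i * y = (q i * x * q i) * (q i * y)"
      using q(2)[OF i] by (metis mult.assoc)
    then have "seminorm (q i * x * q i * y) \<le> norm (q i * x * q i) * seminorm (q i * y)"
      by (metis seminorm_mult)
    also have "\<dots> \<le> \<epsilon> * seminorm (q i * y)" by (intro mult_right_mono le i) simp
    finally have "(seminorm (q i * x * q i * y))\<^sup>2 \<le> (\<epsilon> * seminorm (q i * y))\<^sup>2"
      by (intro power_mono) auto
    then show "(seminorm (q i * x * q i * y))\<^sup>2 \<le> \<epsilon>\<^sup>2 * (seminorm (q i * y))\<^sup>2"
      by (simp add: power_mult_distrib)
  qed
  also have "\<dots> = \<epsilon>\<^sup>2 * (\<Sum>i<n. (seminorm (q i * y))\<^sup>2)" by (simp add: sum_distrib_left)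
  also have "(\<Sum>i<n. (seminorm (q i * y))\<^sup>2) = (seminorm (\<Sum>i<n. q i * y))\<^sup>2"
    by (intro seminorm_sum_orthogonal[symmetric]) (simp add: star_mult q mult.assoc orth')
  also have "(\<Sum>i<n. q i * y) = y" by (simp add: sum flip: sum_distrib_right)
  finally have "(seminorm ((\<Sum>i<n. q i * x * q i) * y))\<^sup>2 \<le> (\<epsilon> * seminorm y)\<^sup>2"
    by (simp add: sum_distrib_right power_mult_distrib)
  then show "seminorm ((\<Sum>i<n. q i * x * q i) * y) \<le> \<epsilon> * seminorm y"
    using \<epsilon> by (simp add: power2_le_iff_abs_le)
qed

text \<open>
  With respect to the projections, \<open>x\<close> is diagonal plus strictly lower plus strictly upper
  triangular; adding \<open>L\<^sup>*\<close> to the lower part \<open>L\<close> makes it self-adjoint and leaves an upper part.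
\<close>

lemma normal_plus_nilpotent:
  fixes q :: "nat \<Rightarrow> 'a"
  assumes proj: "\<And>i. i < n \<Longrightarrow> projection (q i)"
    and orth: "\<And>i j. i < n \<Longrightarrow> j < n \<Longrightarrow> i \<noteq> j \<Longrightarrow> q i * q j = 0"
    and sum: "(\<Sum>i<n. q i) = 1"
    and le: "\<And>i. i < n \<Longrightarrow> norm (q i * x * q i) \<le> \<epsilon>" and \<epsilon>: "\<epsilon> \<ge> 0"
  obtains s t where "self_adjoint s" "nilpotent_element t" "norm (x - (s + t)) \<le> \<epsilon>"
proof -
  have q: "star (q i) = q i" "q i * q i = q i" if "i < n" for i
    using proj[OF that] by (auto simp: projection_def self_adjoint_def)
  define D where "D = (\<Sum>i<n. q i * x * q i)"
  define L where "L = (\<Sum>i<n. \<Sum>j<n. if j < i then q i * x * q j else 0)"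
  define V where "V = (\<Sum>i<n. \<Sum>j<n. if i < j then q i * x * q j else 0)"
  have "x = (\<Sum>i<n. q i) * x * (\<Sum>j<n. q j)" by (simp add: sum)
  also have "\<dots> = (\<Sum>i<n. \<Sum>j<n. q i * x * q j)" by (simp add: sum_distrib_right sum_distrib_left) (rule sum.swap)
  also have "\<dots> = (\<Sum>i<n. \<Sum>j<n. (if j = i then q i * x * q i else 0) +
      (if j < i then q i * x * q j else 0) + (if i < j then q i * x * q j else 0))"
    by (intro sum.cong refl) auto
  also have "\<dots> = D + L + V" by (simp add: D_def L_def V_def sum.distrib)
  finally have x: "x = D + L + V" .
  define t where "t = V - star L"
  \<comment> \<open>The flag that witnesses nilpotency. \<open>E k\<close> stops just before block
    \<open>k\<close>, so \<open>t * q k = E k * (t * q k)\<close> says that \<open>t\<close>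
    strictly lowers the block index, and \<open>t ^ k\<close> annihilates
    \<open>E k\<close>.\<close>
  define E where "E k = (\<Sum>i<k. q i)" for k :: nat
  have sL: "star L = (\<Sum>i<n. \<Sum>j<n. if i < j then q i * star x * q j else 0)"
  proof -
    have "star L = (\<Sum>i<n. \<Sum>j<n. if j < i then q j * star x * q i else 0)"
      unfolding L_def star_sum
      by (intro sum.cong refl) (auto simp: star_mult q star_0 mult.assoc)
    also have "\<dots> = (\<Sum>j<n. \<Sum>i<n. if j < i then q j * star x * q i else 0)" by (rule sum.swap)
    finally show ?thesis .
  qed
  have Eq: "E k * q i = q i" if "i < k" "k \<le> n" for i k
  proof -
    have "E k * q i = (\<Sum>j<k. if j = i then q i else 0)"
      unfolding E_def sum_distrib_right
      by (intro sum.cong refl) (use that in \<open>auto simp: q orth\<close>)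
    then show ?thesis using that by simp
  qed
  \<comment> \<open>Stated for arbitrary \<open>z\<close>, as \<open>V\<close> and
    \<open>star L\<close> have the same strictly triangular form with \<open>x\<close> and
    \<open>star x\<close>.\<close>
  have shift: "E k * (\<Sum>i<n. \<Sum>j<n. if i < j then q i * z * q j else 0) * q k =
      (\<Sum>i<n. \<Sum>j<n. if i < j then q i * z * q j else 0) * q k" if k: "k < n" for k z
  proof -
    have "(\<Sum>i<n. \<Sum>j<n. if i < j then q i * z * q j else 0) * q k =
        (\<Sum>i<n. \<Sum>j<n. if j = k then if i < k then q i * z * q k else 0 else 0)"
      unfolding sum_distrib_right
      by (intro sum.cong refl) (use k in \<open>auto simp: mult.assoc q orth\<close>)
    also have "\<dots> = (\<Sum>i<n. if i < k then q i * z * q k else 0)" using k by simp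
    finally have *: "(\<Sum>i<n. \<Sum>j<n. if i < j then q i * z * q j else 0) * q k =
        (\<Sum>i<n. if i < k then q i * z * q k else 0)" .
    have "E k * (\<Sum>i<n. if i < k then q i * z * q k else 0) = (\<Sum>i<n. if i < k then q i * z * q k else 0)"
      unfolding sum_distrib_left
      by (intro sum.cong refl) (use k Eq in \<open>auto simp flip: mult.assoc\<close>)
    then show ?thesis unfolding mult.assoc[of "E k" _ "q k"] by (simp only: *)
  qed
  have tq: "t * q k = E k * (t * q k)" if k: "k < n" for k
    using shift[OF k, of x] shift[OF k, of "star x"]
    unfolding t_def V_def sL by (simp add: left_diff_distrib right_diff_distrib mult.assoc)
  have nil: "t ^ k * E k = 0" if "k \<le> n" for k
    using that
  proof (induction k)
    case 0
    then show ?case by (simp add: E_def)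
  next
    case (Suc k)
    have "t ^ Suc k * q i = 0" if i: "i \<le> k" for i
    proof -
      have "E k * E i = E i"
        unfolding E_def[of i] sum_distrib_left
        by (intro sum.cong refl Eq) (use i Suc.prems in auto)
      then have "t * q i = E k * (t * q i)"
        using tq[of i] i Suc.prems by (metis Suc_le_lessD le_trans mult.assoc not_less_eq_eq)
      then have "t ^ Suc k * q i = t ^ k * E k * (t * q i)"
        unfolding power_Suc2 by (metis mult.assoc)
      then show ?thesis using Suc by simp
    qed
    then show ?case unfolding E_def sum_distrib_left by (intro sum.neutral) auto
  qed
  have "E n = 1" by (simp add: E_def sum)
  then have "nilpotent_element t" using nil[of n] by (auto simp: nilpotent_element_def)
  moreover have "self_adjoint (L + star L)"
    by (simp add: self_adjoint_def star_add star_star add.commute)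
  moreover have "x - ((L + star L) + t) = D" by (simp add: x t_def)
  moreover have "norm D \<le> \<epsilon>"
    unfolding D_def by (rule norm_block_diagonal[OF proj orth sum le \<epsilon>])
  ultimately show ?thesis using that by metis
qed

end

section \<open>State-preserving embeddings, and the reduced free product as a
  \<open>free_pair\<close>\<close>

lemma
  assumes "embedding \<rho> \<tau> \<theta>"
  shows embedding_one: "\<theta> 1 = 1"
    and embedding_add: "\<theta> (x + y) = \<theta> x + \<theta> y"
    and embedding_scaleC: "\<theta> (c *\<^sub>C x) = c *\<^sub>C \<theta> x"
    and embedding_mult: "\<theta> (x * y) = \<theta> x * \<theta> y"
    and embedding_star: "\<theta> (star x) = star (\<theta> x)"
    and embedding_state: "\<tau> (\<theta> x) = \<rho> x"
  using assms by (auto simp: embedding_def)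

lemma embedding_zero: "embedding \<rho> \<tau> \<theta> \<Longrightarrow> \<theta> 0 = 0"
  using embedding_scaleC[of \<rho> \<tau> \<theta> 0 0] by simp

lemma embedding_sum_list: "embedding \<rho> \<tau> \<theta> \<Longrightarrow> \<theta> (sum_list L) = sum_list (map \<theta> L)"
  by (induction L) (simp_all add: embedding_zero embedding_add)

lemma embedding_projection: "embedding \<rho> \<tau> \<theta> \<Longrightarrow> projection p \<Longrightarrow> projection (\<theta> p)"
  unfolding projection_def self_adjoint_def by (metis embedding_mult embedding_star)

lemma embedding_range:
  assumes "embedding \<rho> \<tau> \<theta>"
  shows "1 \<in> range \<theta>"
    and "x \<in> range \<theta> \<Longrightarrow> y \<in> range \<theta> \<Longrightarrow> x + y \<in> range \<theta>"
    and "x \<in> range \<theta> \<Longrightarrow> y \<in> range \<theta> \<Longrightarrow> x * y \<in> range \<theta>"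
    and "x \<in> range \<theta> \<Longrightarrow> c *\<^sub>C x \<in> range \<theta>"
    and "x \<in> range \<theta> \<Longrightarrow> star x \<in> range \<theta>"
proof -
  show "1 \<in> range \<theta>" by (metis assms embedding_one rangeI)
qed (auto simp flip: embedding_add[OF assms] embedding_mult[OF assms] embedding_scaleC[OF assms]
      embedding_star[OF assms])

lemma free_pair_reduced_free_product:
  assumes "reduced_free_product \<rho>1 \<rho>2 \<tau> \<theta>1 \<theta>2"
  shows "free_pair \<tau> (\<lambda>k. if k then range \<theta>1 else range \<theta>2)"
proof -
  have st: "state \<tau>" "faithful_gns \<tau>" and e: "embedding \<rho>1 \<tau> \<theta>1" "embedding \<rho>2 \<tau> \<theta>2"
    and free: "free_family \<tau> (\<lambda>k. if k then range \<theta>1 else range \<theta>2)"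
    and gen: "cstar_subalgebra hull (range \<theta>1 \<union> range \<theta>2) = UNIV"
    using assms by (auto simp: reduced_free_product_def)
  show ?thesis
    by unfold_locales
      (use free gen embedding_range[OF e(1)] embedding_range[OF e(2)] in
        \<open>auto simp: st separating_faithful_gns split: if_splits\<close>)
qed

lemma nonscalar_self_adjoint:
  assumes "range (\<lambda>c. c *\<^sub>C (1 :: 'a::cstar_algebra)) \<noteq> UNIV"
  obtains h :: "'a::cstar_algebra" where "self_adjoint h" "h \<notin> range (\<lambda>c. c *\<^sub>C 1)"
proof (rule ccontr)
  assume no: "\<not> thesis"
  have *: "h \<in> range (\<lambda>c. c *\<^sub>C 1)" if "self_adjoint h" for h :: 'a
    using that no \<open>\<And>h. self_adjoint h \<Longrightarrow> h \<notin> range (\<lambda>c. c *\<^sub>C 1) \<Longrightarrow> thesis\<close> by blast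
  have "x \<in> range (\<lambda>c. c *\<^sub>C 1)" for x :: 'a
  proof -
    define u where "u = (1 / 2) *\<^sub>C (x + star x)"
    define v where "v = (\<i> / 2) *\<^sub>C (star x - x)"
    have "self_adjoint u"
      by (simp add: u_def self_adjoint_def star_scaleC star_add star_star add.commute)
    then obtain c where c: "u = c *\<^sub>C 1" using * by blast
    have "self_adjoint v"
      by (simp add: v_def self_adjoint_def star_scaleC star_diff star_star scaleC_minus_left scaleC_diff_right)
    then obtain d where d: "v = d *\<^sub>C 1" using * by blast
    have "u + \<i> *\<^sub>C v = (1 / 2 + 1 / 2) *\<^sub>C x"
      by (simp only: scaleC_add_left)
        (simp add: u_def v_def scaleC_scaleC scaleC_diff_right scaleC_add_right scaleC_minus_left)
    then have "x = (c + \<i> * d) *\<^sub>C 1" by (simp add: c d scaleC_add_left scaleC_scaleC)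
    then show ?thesis by blast
  qed
  then show False using assms by blast
qed

theorem theorem8p3:
  fixes \<rho> :: "'a::cstar_algebra \<Rightarrow> complex"
  assumes "selfless TYPE('b::cstar_algebra) TYPE('i) \<rho>"
    and "faithful_state \<rho>"
    and "real_rank_zero TYPE('a)"
  shows "closure {s + t | s t :: 'a. normal_element s \<and> nilpotent_element t} = UNIV"
proof -
  obtain \<tau> :: "'b \<Rightarrow> complex" and \<theta>1 \<theta>2 where prod: "reduced_free_product \<rho> \<rho> \<tau> \<theta>1 \<theta>2"
    and ex: "existential TYPE('i) \<rho> \<tau> \<theta>1"
    and nontriv: "range (\<lambda>c. c *\<^sub>C (1 :: 'a)) \<noteq> UNIV" and state: "state \<rho>"
    using assms(1) by (auto simp: selfless_def)
  obtain U :: "'i filter" and \<sigma> where U: "ultrafilter U" "ultrapower_embedding U \<tau> \<rho> \<sigma>"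
    and diag: "\<And>a. \<sigma> (\<theta>1 a) = up_diag U a"
    using ex by (auto simp: existential_def)
  have e1: "embedding \<rho> \<tau> \<theta>1" and e2: "embedding \<rho> \<tau> \<theta>2"
    using prod by (auto simp: reduced_free_product_def)
  interpret A: ultrapower_lifting \<rho> U \<tau> \<sigma>
    by unfold_locales (use state U separating_faithful[OF assms(2)] in auto)
  interpret B: free_pair \<tau> "\<lambda>k. if k then range \<theta>1 else range \<theta>2"
    by (rule free_pair_reduced_free_product[OF prod])
  have nb: "U \<noteq> bot" using U by (simp add: ultrafilter_def)
  have lift1: "A.lifts (\<theta>1 a) (\<lambda>_. a)" for a
    by (simp add: A.lifts_def diag up_diag_def bounded_families_const)
  have real: "\<rho> p = of_real (Re (\<rho> p))" if "projection p" for p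
    using A.square_eq_seminorm[of p] A.projection_state(1)[OF that] that
    by (simp add: projection_def self_adjoint_def)

  \<comment> \<open>Elements almost free from a given projection\<close>
  obtain h :: 'a where h: "self_adjoint h" "h \<notin> range (\<lambda>c. c *\<^sub>C 1)"
    using nonscalar_self_adjoint[OF nontriv] by blast
  have "cnj (\<rho> h) = \<rho> h" using A.hermitian[of h] h(1) by (simp add: self_adjoint_def)
  \<comment> \<open>The copy of \<open>b\<close> in the second factor is centred and free from the
    first; faithfulness of \<open>\<rho>\<close> gives it positive variance
    \<open>\<beta>\<close>.\<close>
  define b where "b = h - \<rho> h *\<^sub>C 1"
  have b: "self_adjoint b" "\<rho> b = 0" "b \<noteq> 0"
    using h \<open>cnj (\<rho> h) = \<rho> h\<close>
    by (auto simp: b_def self_adjoint_def star_diff star_scaleC A.diff A.scaleC A.one)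
  define \<beta> where "\<beta> = Re (\<rho> (b * b))"
  have "\<rho> (star b * b) \<noteq> 0" using assms(2) b(3) by (auto simp: faithful_state_def)
  then have \<beta>: "\<beta> > 0"
    using b(1) A.Re_pos[of b] A.Im_pos[of b]
    by (auto simp: \<beta>_def self_adjoint_def complex_eq_iff)
  have "self_adjoint (\<theta>2 b)"
    using b(1) by (simp add: self_adjoint_def flip: embedding_star[OF e2])
  \<comment> \<open>One family \<open>x\<close> with one bound \<open>R\<close> serves all
    \<open>e\<close> and \<open>\<eta>\<close>; only the index \<open>i\<close> depends on them.
    This is what allows \<open>split_projection\<close> to give a uniform
    \<open>\<delta>\<close>.\<close>
  then obtain x where x: "A.lifts (\<theta>2 b) x" "\<And>i. self_adjoint (x i)"
    using A.lifts_self_adjoint by blast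
  obtain R where R: "\<And>i. norm (x i) \<le> R"
    using A.lifts_bounded[OF x(1)] by (auto simp: bounded_families_iff)
  then have R0: "R \<ge> 0" using norm_ge_zero order_trans by blast
  have test: "\<exists>x. self_adjoint x \<and> norm x \<le> R \<and>
      \<bar>Re (\<rho> (e * x * e))\<bar> < \<eta> \<and> Re (\<rho> (e * x * e * x * e)) > (Re (\<rho> e))\<^sup>2 * \<beta> - \<eta>"
    if e: "projection e" and \<eta>: "\<eta> > 0" for e \<eta>
  proof -
    have pe: "\<theta>1 e * \<theta>1 e = \<theta>1 e"
      using embedding_projection[OF e1 e] by (simp add: projection_def)
    have \<tau>b: "\<tau> (\<theta>2 b) = 0" by (simp add: embedding_state[OF e2] b)
    have m1: "\<tau> (\<theta>1 e * \<theta>2 b * \<theta>1 e) = 0"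
      using B.free_moments(1)[of "\<theta>1 e" True "\<theta>2 b"] pe \<tau>b by simp
    have "\<tau> (\<theta>1 e * \<theta>2 b * \<theta>1 e * \<theta>2 b * \<theta>1 e) = \<rho> e * \<rho> e * \<rho> (b * b)"
      using B.free_moments(2)[of "\<theta>1 e" True "\<theta>2 b"] pe \<tau>b
      by (simp add: embedding_state[OF e1] embedding_state[OF e2] flip: embedding_mult[OF e2])
    then have m2: "Re (\<tau> (\<theta>1 e * \<theta>2 b * \<theta>1 e * \<theta>2 b * \<theta>1 e)) = (Re (\<rho> e))\<^sup>2 * \<beta>"
      by (subst (asm) (1 2) real[OF e]) (simp add: \<beta>_def power2_eq_square)
    have "((\<lambda>i. Re (\<rho> (e * x i * e))) \<longlongrightarrow> Re (\<tau> (\<theta>1 e * \<theta>2 b * \<theta>1 e))) U"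
      by (intro tendsto_Re A.lifts_state A.lifts_mult lift1 x)
    then have "((\<lambda>i. \<bar>Re (\<rho> (e * x i * e))\<bar>) \<longlongrightarrow> 0) U"
      by (simp add: m1 tendsto_rabs_zero)
    then have "eventually (\<lambda>i. \<bar>Re (\<rho> (e * x i * e))\<bar> < \<eta>) U"
      using \<eta> by (rule order_tendstoD)
    moreover have "((\<lambda>i. Re (\<rho> (e * x i * e * x i * e))) \<longlongrightarrow>
        Re (\<tau> (\<theta>1 e * \<theta>2 b * \<theta>1 e * \<theta>2 b * \<theta>1 e))) U"
      by (intro tendsto_Re A.lifts_state A.lifts_mult lift1 x)
    then have "eventually (\<lambda>i. Re (\<rho> (e * x i * e * x i * e)) > (Re (\<rho> e))\<^sup>2 * \<beta> - \<eta>) U"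
      unfolding m2 by (rule order_tendstoD) (use \<eta> in simp)
    ultimately have "eventually (\<lambda>i. \<bar>Re (\<rho> (e * x i * e))\<bar> < \<eta> \<and>
        Re (\<rho> (e * x i * e * x i * e)) > (Re (\<rho> e))\<^sup>2 * \<beta> - \<eta>) U"
      by (rule eventually_conj)
    then show ?thesis using eventually_happens'[OF nb] R x(2) by blast
  qed

  \<comment> \<open>Approximation of a given element\<close>
  have "a \<in> closure {s + t | s t. normal_element s \<and> nilpotent_element t}" for a :: 'a
    unfolding closure_approachable
  proof (intro allI impI)
    fix \<epsilon> :: real assume \<epsilon>: "\<epsilon> > 0"
    define a0 where "a0 = a - \<rho> a *\<^sub>C 1"
    \<comment> \<open>The summand \<open>1\<close> permits division by \<open>C\<close> even if
      \<open>a\<close> is a scalar.\<close>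
    define C where "C = norm (\<theta>1 a0) + 1"
    have C: "C > 0" "norm (\<theta>1 a0) \<le> C" by (auto simp: C_def add_nonneg_pos)
    have \<tau>a0: "\<tau> (\<theta>1 a0) = 0"
      by (simp add: embedding_state[OF e1] a0_def A.diff A.scaleC A.one)
    \<comment> \<open>Makes the compression bound \<open>2 * sqrt m * C\<close> equal to
      \<open>\<epsilon> / 4\<close>; lifting the norm estimate costs another
      \<open>\<epsilon> / 4\<close>, and the total \<open>\<epsilon> / 2\<close> is strictly below
      \<open>\<epsilon>\<close>.\<close>
    define m where "m = (\<epsilon> / (8 * C))\<^sup>2"
    have m: "m > 0" "sqrt m = \<epsilon> / (8 * C)" using \<epsilon> C by (auto simp: m_def)
    obtain \<delta> where \<delta>: "\<delta> > 0" and split: "\<And>e. projection e \<Longrightarrow> Re (\<rho> e) \<ge> m \<Longrightarrow>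
        \<exists>f. projection f \<and> e * f = f \<and> \<delta> < Re (\<rho> f) \<and> Re (\<rho> f) < Re (\<rho> e) - \<delta>"
      using A.split_projection[OF assms(3) m(1) \<beta> R0 test] by blast
    \<comment> \<open>The budget \<open>real n * \<delta>\<close> has to exceed \<open>1\<close>,
      the state of the unit.\<close>
    obtain n where "1 / \<delta> < real n" using reals_Archimedean2 by blast
    then have "Re (\<rho> 1) < m + real n * \<delta>" using \<delta> m(1) by (simp add: A.one field_simps)
    then obtain ps where ps: "A.orthogonal_projections ps" "\<And>p. p \<in> set ps \<Longrightarrow> Re (\<rho> p) < m"
      "sum_list ps = 1"
      using A.partition_projection[OF split projection_one] by blast
    \<comment> \<open>Moved into the second factor, the partition is free from
      \<open>\<theta>1 a0\<close>. Its lifts then act on \<open>a0\<close> itself, because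
      \<open>\<sigma>\<close> after \<open>\<theta>1\<close> is the diagonal embedding.\<close>
    define P where "P i = \<theta>2 (ps ! i)" for i
    define N where "N = length ps"
    have proj: "projection (ps ! i)" if "i < N" for i
      using ps(1) that by (simp add: A.orthogonal_projections_def N_def)
    have projP: "projection (P i)" if "i < N" for i
      unfolding P_def by (rule embedding_projection[OF e2 proj[OF that]])
    have "ps ! i * ps ! j = 0" if "i < j" "j < N" for i j
      using ps(1) that by (simp add: A.orthogonal_projections_def N_def sorted_wrt_iff_nth_less)
    then have "ps ! i * ps ! j = 0" if "i < N" "j < N" "i \<noteq> j" for i j
      using that A.projection_orthogonal_sym[OF proj[of j] proj[of i]] by (metis linorder_neqE_nat)
    then have orthP: "P i * P j = 0" if "i < N" "j < N" "i \<noteq> j" for i j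
      using that by (simp add: P_def embedding_zero[OF e2] flip: embedding_mult[OF e2])
    have "(\<Sum>i<N. P i) = sum_list (map \<theta>2 ps)"
      by (simp add: sum_list_sum_nth P_def N_def lessThan_atLeast0)
    then have sumP: "(\<Sum>i<N. P i) = 1"
      using embedding_sum_list[OF e2, of ps] by (simp add: ps(3) embedding_one[OF e2])
    obtain q where q: "\<And>i. i < N \<Longrightarrow> A.lifts (P i) (q i)"
      "eventually (\<lambda>t. (\<forall>i<N. projection (q i t)) \<and> (\<forall>i<N. \<forall>j<N. i \<noteq> j \<longrightarrow> q i t * q j t = 0) \<and>
        (\<Sum>i<N. q i t) = 1) U"
      using A.lifts_projection_partition[of N P] projP orthP sumP by blast
    have "eventually (\<lambda>t. norm (q i t * a0 * q i t) \<le> \<epsilon> / 2) U" if i: "i < N" for i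
    proof -
      have "norm (P i * \<theta>1 a0 * P i) \<le> 2 * sqrt (Re (\<tau> (P i))) * norm (\<theta>1 a0)"
        by (rule B.norm_free_compression[of _ True]) (use projP[OF i] \<tau>a0 in \<open>auto simp: P_def\<close>)
      also have "\<dots> \<le> 2 * sqrt m * C"
        using ps(2)[of "ps ! i"] A.projection_state(2)[OF proj[OF i]] m(1) i C
        by (intro mult_mono) (auto simp: P_def embedding_state[OF e2] N_def less_imp_le)
      also have "\<dots> = \<epsilon> / 4" using C by (simp add: m)
      finally have le: "norm (P i * \<theta>1 a0 * P i) + \<epsilon> / 4 \<le> \<epsilon> / 2" by simp
      have "A.lifts (P i * \<theta>1 a0 * P i) (\<lambda>t. q i t * a0 * q i t)"
        by (intro A.lifts_mult lift1 q i)
      then have "eventually (\<lambda>t. norm (q i t * a0 * q i t) \<le> norm (P i * \<theta>1 a0 * P i) + \<epsilon> / 4) U"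
        by (rule A.lifts_norm) (use \<epsilon> in simp)
      then show ?thesis by (rule eventually_mono) (use le in linarith)
    qed
    then have ev: "eventually (\<lambda>t. \<forall>i\<in>{..<N}. norm (q i t * a0 * q i t) \<le> \<epsilon> / 2) U"
      by (intro eventually_ball_finite) auto
    from eventually_happens'[OF nb eventually_conj[OF q(2) ev]]
    obtain t where t: "\<forall>i<N. projection (q i t)" "\<forall>i<N. \<forall>j<N. i \<noteq> j \<longrightarrow> q i t * q j t = 0"
      "(\<Sum>i<N. q i t) = 1" "\<forall>i<N. norm (q i t * a0 * q i t) \<le> \<epsilon> / 2"
      by auto
    obtain s v where sv: "self_adjoint s" "nilpotent_element v" "norm (a0 - (s + v)) \<le> \<epsilon> / 2"
      by (rule A.normal_plus_nilpotent[of N "\<lambda>i. q i t" a0 "\<epsilon> / 2"]) (use t \<epsilon> in auto)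
    have "normal_element (s + \<rho> a *\<^sub>C 1)"
      using sv(1) by (simp add: normal_element_def self_adjoint_def star_add star_scaleC
          distrib_left distrib_right mult_scaleC_left mult_scaleC_right scaleC_add_right scaleC_scaleC add_ac mult_ac)
    moreover have "dist ((s + \<rho> a *\<^sub>C 1) + v) a < \<epsilon>"
    proof -
      have "norm (((s + \<rho> a *\<^sub>C 1) + v) - a) = norm (a0 - (s + v))"
        by (subst norm_minus_commute) (simp add: a0_def algebra_simps)
      then show ?thesis using sv(3) \<epsilon> by (simp add: dist_norm)
    qed
    ultimately show "\<exists>y\<in>{s + t | s t. normal_element s \<and> nilpotent_element t}. dist y a < \<epsilon>"
      using sv(2) by blast
  qed
  then show ?thesis by blast
qed

end
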